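(* Let $\mu>0$ and $0<\zeta<1$ be fixed. For each $N$ let $\gamma=\gamma_N\ge 1$ with $\log\gamma\sim N^{\zeta}$ as $N\to\infty$, and let $T=T_N$ be a stopping rule for the $N$-stream model such that $\mathrm{ARL}(T)\ge\gamma$. (a) If $p=p_N\sim N^{-\beta}$ with $0<\beta<1$ and $\frac{1-\zeta}{2}<\beta<1-\zeta$, then $$\liminf_{N\to\infty}\frac{D_N(T)}{\log N}\ \ge\ 2\mu^{-2}\rho(\beta,\zeta).$$ (b) If $p=p_N\sim N^{-\beta}$ with $0<\beta<1$ and $\beta>1-\zeta$, then $$\liminf_{N\to\infty}\frac{\log D_N(T)}{\log N}\ \ge\ \beta+\zeta-1.$$
   Context: Model: there are $N$ data streams; $X_{nt}$ ($1\le n\le N$, $t\ge1$ integer) is the observation of stream $n$ at time $t$. The set $\mathcal N\subset\{1,\dots,N\}$ of affected streams is random, with $\mathbf 1_{\{1\in\mathcal N\}},\dots,\mathbf 1_{\{N\in\mathcal N\}}$ i.i.d. Bernoulli($p$), $0<p<1$. For a change-point $\nu\in\{1,2,\dots\}$, under $P_\nu$ (expectation $E_\nu$), conditionally on $\mathcal N$ the $X_{nt}$ are independent with $X_{nt}\sim N(\mu_{nt},1)$, where $\mu_{nt}=\mu\,\mathbf 1_{\{t\ge\nu,\ n\in\mathcal N\}}$. Under $P_\infty$ ($E_\infty$) there is no change: all $X_{nt}$ are i.i.d. $N(0,1)$. A stopping rule $T$ is a stopping time (values in $\{1,2,\dots\}\cup\{\infty\}$) with respect to the filtration generated by the observations $\{X_{nu}:1\le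 n\le N,\ u\le t\}$, $t\ge1$. Its average run length is $\mathrm{ARL}(T)=E_\infty T$, and its detection delay is $$D_N(T)=\sup_{1\le\nu<\infty}E_\nu(T-\nu+1\mid T\ge\nu),$$ the supremum being over those $\nu$ for which the conditioning event has positive probability. The constant $\rho(\beta,\zeta)$ is $$\rho(\beta,\zeta)=\begin{cases}\beta-\frac{1-\zeta}{2} & \text{if }\frac{1-\zeta}{2}<\beta\le\frac{3(1-\zeta)}{4},\\[2pt] \left(\sqrt{1-\zeta}-\sqrt{1-\zeta-\beta}\right)^2 & \text{if }\frac{3(1-\zeta)}{4}<\beta<1-\zeta.\end{cases}$$ Here $a_N\sim b_N$ means $a_N/b_N\to1$ as $N\to\infty$. *)

theory Defs
  imports "HOL-Probability.Probability" "HOL-Library.Landau_Symbols"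
begin

text \<open>
  The model is realised on its canonical space: an outcome is a function \<open>\<omega>\<close>, and
  \<open>\<omega> (n, t)\<close> is the observation \<open>X\<^sub>n\<^sub>t\<close> of stream \<open>n \<in> {1..N}\<close> at time
  \<open>t \<ge> 1\<close>.
\<close>

type_synonym path = "nat \<times> nat \<Rightarrow> real"

definition normal_law :: "real \<Rightarrow> real measure" where
  "normal_law m = density lborel (\<lambda>x. ennreal (normal_density m 1 x))"

text \<open>The law \<open>P\<^sub>\<infinity>\<close> of the observations when there is no change.\<close>

definition null_law :: "nat \<Rightarrow> path measure" where
  "null_law N = (\<Pi>\<^sub>M i \<in> {1..N} \<times> {1..}. normal_law 0)"

definition signal_mean :: "real \<Rightarrow> nat \<Rightarrow> nat set \<Rightarrow> nat \<Rightarrow> nat \<Rightarrow> real" where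
  "signal_mean \<mu> \<nu> A n t = (if \<nu> \<le> t \<and> n \<in> A then \<mu> else 0)"

definition affected_pmf :: "nat \<Rightarrow> real \<Rightarrow> nat set pmf" where
  "affected_pmf N p =
     map_pmf (\<lambda>b. {n \<in> {1..N}. b n}) (Pi_pmf {1..N} False (\<lambda>_. bernoulli_pmf p))"

text \<open>The conditional law of the observations given that the affected set is \<open>A\<close>.\<close>

definition cond_law :: "nat \<Rightarrow> real \<Rightarrow> nat \<Rightarrow> nat set \<Rightarrow> path measure" where
  "cond_law N \<mu> \<nu> A =
     (\<Pi>\<^sub>M (n, t) \<in> {1..N} \<times> {1..}. normal_law (signal_mean \<mu> \<nu> A n t))"

text \<open>
  The law \<open>P\<^sub>\<nu>\<close> of the observations: first the random affected set is drawn, then the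
  observations. The affected set itself is integrated out, as stopping rules may not depend on it.
\<close>

definition change_law :: "nat \<Rightarrow> real \<Rightarrow> real \<Rightarrow> nat \<Rightarrow> path measure" where
  "change_law N p \<mu> \<nu> = measure_pmf (affected_pmf N p) \<bind> cond_law N \<mu> \<nu>"

text \<open>
  Time is indexed by \<^typ>\<open>enat\<close> so that stopping times may be infinite; at \<open>t = \<infinity>\<close> this is the
  \<open>\<sigma>\<close>-algebra generated by all observations, and at finite \<open>t\<close> the requirement on stopping
  times is the usual one.
\<close>

definition obs_filtration :: "nat \<Rightarrow> enat \<Rightarrow> path measure" where
  "obs_filtration N t =
     (let \<Omega> = space (null_law N) in
      sigma \<Omega> {{\<omega> \<in> \<Omega>. \<omega> (n, u) \<in> B} | n u B.
                n \<in> {1..N} \<and> 1 \<le> u \<and> enat u \<le> t \<and> B \<in> sets borel})"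

definition stopping_rule :: "nat \<Rightarrow> (path \<Rightarrow> enat) \<Rightarrow> bool" where
  "stopping_rule N T \<longleftrightarrow>
     stopping_time (obs_filtration N) T \<and> (\<forall>\<omega> \<in> space (null_law N). 1 \<le> T \<omega>)"

definition ARL :: "nat \<Rightarrow> (path \<Rightarrow> enat) \<Rightarrow> ennreal" where
  "ARL N T = (\<integral>\<^sup>+ \<omega>. ennreal_of_enat (T \<omega>) \<partial>null_law N)"

definition not_stopped :: "nat \<Rightarrow> (path \<Rightarrow> enat) \<Rightarrow> nat \<Rightarrow> path set" where
  "not_stopped N T \<nu> = {\<omega> \<in> space (null_law N). enat \<nu> \<le> T \<omega>}"

text \<open>
  The expectation of \<open>T - \<nu> + 1\<close> under \<open>P\<^sub>\<nu>\<close> conditioned on the event \<open>T \<ge> \<nu>\<close>, on which the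
  truncated subtraction of \<^typ>\<open>enat\<close> is the ordinary one (and \<open>\<infinity> - \<nu> = \<infinity>\<close>).
\<close>

definition cond_delay ::
    "nat \<Rightarrow> real \<Rightarrow> real \<Rightarrow> (path \<Rightarrow> enat) \<Rightarrow> nat \<Rightarrow> ennreal" where
  "cond_delay N p \<mu> T \<nu> =
     (\<integral>\<^sup>+ \<omega>. ennreal_of_enat (T \<omega> - enat \<nu> + 1)
        \<partial>uniform_measure (change_law N p \<mu> \<nu>) (not_stopped N T \<nu>))"

definition detection_delay :: "nat \<Rightarrow> real \<Rightarrow> real \<Rightarrow> (path \<Rightarrow> enat) \<Rightarrow> ennreal" where
  "detection_delay N p \<mu> T =
     (SUP \<nu> \<in> {\<nu>. 1 \<le> \<nu> \<and> 0 < emeasure (change_law N p \<mu> \<nu>) (not_stopped N T \<nu>)}.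
        cond_delay N p \<mu> T \<nu>)"

text \<open>Only meaningful for \<open>(1 - \<zeta>) / 2 < \<beta> < 1 - \<zeta>\<close>.\<close>

definition rho :: "real \<Rightarrow> real \<Rightarrow> real" where
  "rho \<beta> \<zeta> =
     (if \<beta> \<le> 3 * (1 - \<zeta>) / 4 then \<beta> - (1 - \<zeta>) / 2
      else (sqrt (1 - \<zeta>) - sqrt (1 - \<zeta> - \<beta>))\<^sup>2)"

definition ext_ln :: "ennreal \<Rightarrow> ereal" where
  "ext_ln d = (if d = 0 then -\<infinity> else if d = \<infinity> then \<infinity> else ereal (ln (enn2real d)))"

lemma prob_space_normal_law: "prob_space (normal_law m)"
  unfolding normal_law_def by (rule prob_space_normal_density) simp

lemma sets_normal_law [simp, measurable_cong]: "sets (normal_law m) = sets borel"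
  by (simp add: normal_law_def)

lemma prob_space_null_law: "prob_space (null_law N)"
  unfolding null_law_def by (intro prob_space_PiM prob_space_normal_law)

lemma prob_space_cond_law: "prob_space (cond_law N \<mu> \<nu> A)"
  unfolding cond_law_def
  by (intro prob_space_PiM) (auto simp: prob_space_normal_law split: prod.split)

lemma sets_cond_law [simp]: "sets (cond_law N \<mu> \<nu> A) = sets (null_law N)"
  unfolding cond_law_def null_law_def by (intro sets_PiM_cong) auto

lemma cond_law_measurable [measurable]:
  "cond_law N \<mu> \<nu> \<in> measure_pmf (affected_pmf N p) \<rightarrow>\<^sub>M prob_algebra (null_law N)"
  by (auto simp: space_prob_algebra prob_space_cond_law)

lemma sets_change_law [simp]: "sets (change_law N p \<mu> \<nu>) = sets (null_law N)"
  unfolding change_law_def by (rule sets_bind) auto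

lemma prob_space_change_law: "prob_space (change_law N p \<mu> \<nu>)"
  unfolding change_law_def
  by (rule prob_space_bind'[OF _ cond_law_measurable])
     (simp add: space_prob_algebra prob_space_measure_pmf)

end

theory Submission
  imports Defs "HOL-Real_Asymp.Real_Asymp"
begin

text \<open>
  Since \<open>ARL \<ge> \<gamma>\<close>, for every window length \<open>m\<close> there is a \<open>\<nu>\<close> such that, given \<open>T \<ge> \<nu>\<close>, the rule stops
  in the window \<open>[\<nu>, \<nu> + m)\<close> with \<open>P\<^sub>\<infinity>\<close>-probability at most \<open>2 m / \<gamma>\<close>. If this conditional
  probability is also \<open>o(1)\<close> under \<open>P\<^sub>\<nu>\<close>, the delay is at least \<open>m (1 - o(1))\<close>. The change of measure
  to \<open>P\<^sub>\<nu>\<close> has density \<open>L = \<Prod>\<^sub>n (1 - p + p x\<^sub>n)\<close> with \<open>x\<^sub>n\<close> the likelihood ratio of stream \<open>n\<close> over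
  the window, and it is controlled by moments.

  For \<open>\<beta> < 1 - \<zeta>\<close> and \<open>0 < s \<le> 1\<close> one has \<open>L \<le> \<surd>\<gamma> + \<gamma> powr (-s/2) L powr (1 + s)\<close> and
  \<open>E\<^sub>\<infinity> (L powr (1 + s)) \<le> (1 + p powr (1 + s) exp (s (1 + s) m \<mu>\<^sup>2 / 2))\<^sup>N\<close>. With
  \<open>m = 2 \<mu>\<^sup>-\<^sup>2 r log N\<close> the logarithm of this bound is of order \<open>N\<close> to the power
  \<open>1 - (1 + s) (\<beta> - s r)\<close>, which is below \<open>\<zeta>\<close> for a suitable \<open>s\<close> as soon as \<open>r < \<rho>\<close>.

  For \<open>\<beta> > 1 - \<zeta>\<close> one takes \<open>m\<close> a power of \<open>N\<close> and conditions on the affected set \<open>A\<close>: if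
  \<open>|A| \<le> K\<close>, the second moment \<open>exp (|A| m \<mu>\<^sup>2)\<close> of the density suffices, and \<open>|A| > K\<close> has
  probability at most \<open>N p / K\<close>.
\<close>

subsection \<open>Products of probability spaces\<close>

text \<open>Independence means that the joint law is the product of the marginals. Here the joint
  map is the identity on the product space, so both sides are \<open>PiM I M\<close>; that criterion
  needs a nonempty index set.\<close>

lemma indep_vars_PiM_coordinates:
  assumes M: "\<And>i. i \<in> I \<Longrightarrow> prob_space (M i)"
  shows "prob_space.indep_vars (PiM I M) M (\<lambda>i \<omega>. \<omega> i) I"
proof -
  interpret P: prob_space "PiM I M" using M by (rule prob_space_PiM)
  show ?thesis
  proof (cases "I = {}")
    case True
    show ?thesis unfolding P.indep_vars_def P.indep_sets_def using True by auto
  next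
    case False
    have "distr (PiM I M) (PiM I M) (\<lambda>x. \<lambda>i\<in>I. x i) = distr (PiM I M) (PiM I M) (\<lambda>x. x)"
      by (rule distr_cong) (auto simp: space_PiM)
    also have "\<dots> = PiM I M" by (rule distr_id2) simp
    also have "\<dots> = (\<Pi>\<^sub>M i\<in>I. distr (PiM I M) (M i) (\<lambda>\<omega>. \<omega> i))"
      by (rule PiM_cong[OF refl]) (rule distr_PiM_component[symmetric], rule M)
    finally show ?thesis
      using False by (subst P.indep_vars_iff_distr_eq_PiM') auto
  qed
qed

lemma nn_integral_PiM_prod:
  fixes g :: "'i \<Rightarrow> 'a \<Rightarrow> ennreal"
  assumes M: "\<And>i. i \<in> I \<Longrightarrow> prob_space (M i)" and K: "finite K" "K \<subseteq> I"
    and g: "\<And>i. i \<in> K \<Longrightarrow> g i \<in> borel_measurable (M i)"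
  shows "(\<integral>\<^sup>+\<omega>. (\<Prod>i\<in>K. g i (\<omega> i)) \<partial>PiM I M) = (\<Prod>i\<in>K. \<integral>\<^sup>+x. g i x \<partial>M i)"
proof -
  interpret P: prob_space "PiM I M" using M by (rule prob_space_PiM)
  have "P.indep_vars M (\<lambda>i \<omega>. \<omega> i) K"
    using indep_vars_PiM_coordinates[of I M, OF M] K(2) by (rule P.indep_vars_subset)
  then have "P.indep_vars (\<lambda>_. borel) (\<lambda>i \<omega>. g i (\<omega> i)) K"
    by (rule P.indep_vars_compose2) (rule g)
  then have "(\<integral>\<^sup>+\<omega>. (\<Prod>i\<in>K. g i (\<omega> i)) \<partial>PiM I M) = (\<Prod>i\<in>K. \<integral>\<^sup>+\<omega>. g i (\<omega> i) \<partial>PiM I M)"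
    by (intro P.indep_vars_nn_integral K) auto
  also have "\<dots> = (\<Prod>i\<in>K. \<integral>\<^sup>+x. g i x \<partial>M i)"
  proof (rule prod.cong[OF refl])
    fix i assume i: "i \<in> K"
    then have "i \<in> I" using K by auto
    have "(\<integral>\<^sup>+\<omega>. g i (\<omega> i) \<partial>PiM I M) = (\<integral>\<^sup>+x. g i x \<partial>distr (PiM I M) (M i) (\<lambda>\<omega>. \<omega> i))"
      using \<open>i \<in> I\<close> g[OF i] by (subst nn_integral_distr) auto
    also have "distr (PiM I M) (M i) (\<lambda>\<omega>. \<omega> i) = M i"
      by (rule distr_PiM_component) (use M \<open>i \<in> I\<close> in auto)
    finally show "(\<integral>\<^sup>+\<omega>. g i (\<omega> i) \<partial>PiM I M) = (\<integral>\<^sup>+x. g i x \<partial>M i)" .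
  qed
  finally show ?thesis .
qed

text \<open>Both measures are compared on cylinders, where the integral factorises over coordinates.
  Since \<open>W\<close> is finite, the product of the densities is a genuine function on the
  possibly infinite product.\<close>

lemma PiM_density_finite:
  fixes f :: "'i \<Rightarrow> 'a \<Rightarrow> ennreal"
  assumes M: "\<And>i. i \<in> I \<Longrightarrow> prob_space (M i)" and W: "finite W" "W \<subseteq> I"
    and f [measurable]: "\<And>i. i \<in> W \<Longrightarrow> f i \<in> borel_measurable (M i)"
    and 1: "\<And>i. i \<in> W \<Longrightarrow> prob_space (density (M i) (f i))"
  shows "density (PiM I M) (\<lambda>\<omega>. \<Prod>i\<in>W. f i (\<omega> i)) =
    PiM I (\<lambda>i. if i \<in> W then density (M i) (f i) else M i)" (is "?P = PiM I ?M'")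
proof (rule measure_eqI_PiM_infinite)
  have M': "prob_space (?M' i)" if "i \<in> I" for i using that M 1 by auto
  interpret P: prob_space "PiM I M" using M by (rule prob_space_PiM)
  show "sets ?P = sets (PiM I M)" by simp
  show s: "sets (PiM I ?M') = sets (PiM I M)" by (intro sets_PiM_cong) auto
  have [measurable]: "(\<lambda>\<omega>. \<Prod>i\<in>W. f i (\<omega> i)) \<in> borel_measurable (PiM I M)"
    using W f by (auto intro!: borel_measurable_prod_ennreal measurable_compose[OF measurable_component_singleton])
  have eq: "emeasure ?P (prod_emb I M J (Pi\<^sub>E J A)) =
            emeasure (PiM I ?M') (prod_emb I M J (Pi\<^sub>E J A))"
    if J: "finite J" "J \<subseteq> I" and A: "\<And>i. i \<in> J \<Longrightarrow> A i \<in> sets (M i)" for A J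
  proof -
    \<comment> \<open>One factor per coordinate, merging density and cylinder indicator, so that the
      product formula applies on \<open>W \<union> J\<close>.\<close>
    define g where "g i x = (if i \<in> W then f i x else 1) * (if i \<in> J then indicator (A i) x else 1)" for i x
    have gm: "g i \<in> borel_measurable (M i)" if "i \<in> W \<union> J" for i
      using that A f unfolding g_def by (cases "i \<in> W"; cases "i \<in> J") auto
    \<comment> \<open>A coordinate tilted but not constrained contributes 1, because
      \<open>f i\<close> is a probability density.\<close>
    have int_g: "(\<integral>\<^sup>+x. g i x \<partial>M i) = (if i \<in> J then emeasure (?M' i) (A i) else 1)" if "i \<in> W \<union> J" for i
    proof -
      have "emeasure (density (M i) (f i)) (space (M i)) = 1" if "i \<in> W"
        using prob_space.emeasure_space_1[OF 1[OF that]] by simp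
      then show ?thesis using that f A unfolding g_def
        by (auto simp: emeasure_density intro!: nn_integral_cong split: split_indicator)
    qed
    have "emeasure ?P (prod_emb I M J (Pi\<^sub>E J A)) =
        (\<integral>\<^sup>+\<omega>. (\<Prod>i\<in>W. f i (\<omega> i)) * indicator (prod_emb I M J (Pi\<^sub>E J A)) \<omega> \<partial>PiM I M)"
      using J A by (intro emeasure_density) (auto intro!: sets_PiM_I)
    also have "\<dots> = (\<integral>\<^sup>+\<omega>. (\<Prod>i\<in>W \<union> J. g i (\<omega> i)) \<partial>PiM I M)"
    proof (rule nn_integral_cong)
      fix \<omega> assume \<omega>: "\<omega> \<in> space (PiM I M)"
      have "indicator (prod_emb I M J (Pi\<^sub>E J A)) \<omega> = (\<Prod>i\<in>J. indicator (A i) (\<omega> i) :: ennreal)"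
      proof (cases "\<forall>i\<in>J. \<omega> i \<in> A i")
        case True
        then show ?thesis using \<omega> by (auto simp: indicator_def prod_emb_def space_PiM PiE_iff)
      next
        case False
        then have "(\<Prod>i\<in>J. indicator (A i) (\<omega> i) :: ennreal) = 0"
          using J by (intro prod_zero) (auto simp: indicator_def)
        then show ?thesis using False by (auto simp: indicator_def prod_emb_def PiE_iff)
      qed
      moreover have "(\<Prod>i\<in>W \<union> J. if i \<in> W then f i (\<omega> i) else 1) = (\<Prod>i\<in>W. f i (\<omega> i))"
        using W J by (intro prod.mono_neutral_cong_right) auto
      moreover have "(\<Prod>i\<in>W \<union> J. if i \<in> J then indicator (A i) (\<omega> i) else 1) = (\<Prod>i\<in>J. indicator (A i) (\<omega> i) :: ennreal)"
        using W J by (intro prod.mono_neutral_cong_right) auto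
      ultimately show "(\<Prod>i\<in>W. f i (\<omega> i)) * indicator (prod_emb I M J (Pi\<^sub>E J A)) \<omega> = (\<Prod>i\<in>W \<union> J. g i (\<omega> i))"
        by (simp add: g_def prod.distrib)
    qed
    also have "\<dots> = (\<Prod>i\<in>W \<union> J. \<integral>\<^sup>+x. g i x \<partial>M i)"
      using W J gm by (intro nn_integral_PiM_prod M) auto
    also have "\<dots> = (\<Prod>i\<in>W \<union> J. if i \<in> J then emeasure (?M' i) (A i) else 1)"
      by (intro prod.cong int_g refl)
    also have "\<dots> = (\<Prod>i\<in>J. emeasure (?M' i) (A i))"
      using W J by (intro prod.mono_neutral_cong_right) auto
    also have "\<dots> = emeasure (PiM I ?M') (prod_emb I ?M' J (Pi\<^sub>E J A))"
      by (rule emeasure_PiM_emb[symmetric]) (use J A M' in auto)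
    also have "prod_emb I ?M' J (Pi\<^sub>E J A) = prod_emb I M J (Pi\<^sub>E J A)"
      unfolding prod_emb_def by (intro arg_cong2[where f="(\<inter>)"] refl PiE_cong) auto
    finally show ?thesis .
  qed
  show "emeasure ?P (prod_emb I M J (Pi\<^sub>E J A)) = emeasure (PiM I ?M') (prod_emb I M J (Pi\<^sub>E J A))"
    if "finite J" "J \<subseteq> I" "\<And>i. i \<in> J \<Longrightarrow> A i \<in> sets (M i)" for A J
    using that by (rule eq)
  interpret P': prob_space "PiM I ?M'" using M' by (rule prob_space_PiM)
  have prod_emb_empty_eq: "prod_emb I M {} {\<lambda>x. undefined} = space (PiM I M)"
    by (auto simp: prod_emb_def space_PiM restrict_def)
  have "emeasure (PiM I ?M') (space (PiM I ?M')) = 1"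
    by (rule P'.emeasure_space_1)
  moreover have "emeasure ?P (space (PiM I M)) = emeasure (PiM I ?M') (space (PiM I M))"
    using eq[of "{}" "\<lambda>_. {}"] by (simp add: prod_emb_empty_eq)
  ultimately show "finite_measure ?P"
    using sets_eq_imp_space_eq[OF s] by (intro finite_measureI) (simp add: space_density)
qed

lemma emeasure_PiM_restrict:
  assumes M: "\<And>i. prob_space (M i)" and J: "finite J" "J \<subseteq> I" and E: "E \<in> sets (PiM J M)"
  shows "emeasure (PiM I M) {\<omega> \<in> space (PiM I M). restrict \<omega> J \<in> E} = emeasure (PiM J M) E"
proof -
  interpret product_prob_space M I
    by (intro product_prob_spaceI M)
  have "emeasure (PiM J M) E = emeasure (distr (PiM I M) (PiM J M) (\<lambda>x. restrict x J)) E"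
    using J by (subst distr_PiM_restrict_finite) auto
  also have "\<dots> = emeasure (PiM I M) ((\<lambda>x. restrict x J) -` E \<inter> space (PiM I M))"
    using J E by (intro emeasure_distr measurable_restrict_subset) auto
  also have "(\<lambda>x. restrict x J) -` E \<inter> space (PiM I M) = {\<omega> \<in> space (PiM I M). restrict \<omega> J \<in> E}"
    by auto
  finally show ?thesis by simp
qed

text \<open>Sets that depend measurably on the coordinates in \<open>J\<close> alone form a
  \<sigma>-algebra, so it is enough to look at the generators. This turns adaptedness into
  dependence on a block of coordinates.\<close>

lemma sigma_sets_coordinates_restrict:
  assumes J: "J \<subseteq> I"
    and "E \<in> sigma_sets (space (PiM I M)) {{\<omega> \<in> space (PiM I M). \<omega> i \<in> B} | i B. i \<in> J \<and> B \<in> sets (M i)}"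
  shows "\<exists>E'\<in>sets (PiM J M). E = {\<omega> \<in> space (PiM I M). restrict \<omega> J \<in> E'}"
  using assms(2)
proof induction
  case (Basic a)
  then obtain i B where i: "i \<in> J" "B \<in> sets (M i)" "a = {\<omega> \<in> space (PiM I M). \<omega> i \<in> B}" by auto
  have "{x \<in> space (PiM J M). x i \<in> B} \<in> sets (PiM J M)" using i by measurable
  moreover have "a = {\<omega> \<in> space (PiM I M). restrict \<omega> J \<in> {x \<in> space (PiM J M). x i \<in> B}}"
    using i J by (auto simp: space_PiM)
  ultimately show ?case by blast
next
  case Empty
  show ?case by (intro bexI[of _ "{}"]) auto
next
  case (Compl a)
  then obtain E' where E': "E' \<in> sets (PiM J M)" "a = {\<omega> \<in> space (PiM I M). restrict \<omega> J \<in> E'}" by blast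
  have "restrict \<omega> J \<in> space (PiM J M)" if "\<omega> \<in> space (PiM I M)" for \<omega>
    using that J by (auto simp: space_PiM)
  then have "space (PiM I M) - a = {\<omega> \<in> space (PiM I M). restrict \<omega> J \<in> space (PiM J M) - E'}"
    using E' by blast
  then show ?case using E' by blast
next
  case (Union a)
  then have "\<forall>i. \<exists>E'. E' \<in> sets (PiM J M) \<and> a i = {\<omega> \<in> space (PiM I M). restrict \<omega> J \<in> E'}"
    by blast
  then obtain E' where E': "\<And>i. E' i \<in> sets (PiM J M)"
      "\<And>i. a i = {\<omega> \<in> space (PiM I M). restrict \<omega> J \<in> E' i}"
    by (auto dest!: choice)
  then have "(\<Union>i. a i) = {\<omega> \<in> space (PiM I M). restrict \<omega> J \<in> (\<Union>i. E' i)}"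
    by auto
  moreover have "(\<Union>i. E' i) \<in> sets (PiM J M)" using E'(1) by auto
  ultimately show ?case by blast
qed

subsection \<open>Likelihood ratios over a window\<close>

lemma space_normal_law [simp]: "space (normal_law m) = UNIV"
  by (simp add: normal_law_def)

lemma borel_measurable_normal_law [simp]: "borel_measurable (normal_law m) = borel_measurable borel"
  by (rule measurable_cong_sets) simp_all

lemma density_normal_law:
  "density (normal_law 0) (\<lambda>x. ennreal (exp (\<mu> * x - \<mu>\<^sup>2 / 2))) = normal_law \<mu>"
proof -
  have "normal_density 0 1 x * exp (\<mu> * x - \<mu>\<^sup>2 / 2) = normal_density \<mu> 1 x" for x
    by (simp add: normal_density_def power2_eq_square exp_add[symmetric] mult.assoc field_simps)
  then show ?thesis
    unfolding normal_law_def
    by (subst density_density_eq) (auto simp: ennreal_mult[symmetric] intro!: density_cong)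
qed

text \<open>Completing the square: the power \<open>a\<close> of the likelihood ratio for mean \<mu>
  is a constant times the likelihood ratio for mean \<open>a * \<mu>\<close>, which integrates to
  1.\<close>

lemma nn_integral_exp_normal_law:
  "(\<integral>\<^sup>+x. ennreal (exp (a * (\<mu> * x - \<mu>\<^sup>2 / 2))) \<partial>normal_law 0) = ennreal (exp (a * (a - 1) * \<mu>\<^sup>2 / 2))"
proof -
  have eq: "exp (a * (\<mu> * x - \<mu>\<^sup>2 / 2)) =
      exp (a * (a - 1) * \<mu>\<^sup>2 / 2) * exp ((a * \<mu>) * x - (a * \<mu>)\<^sup>2 / 2)" for x
    by (simp add: exp_add[symmetric] power2_eq_square field_simps)
  have "(\<integral>\<^sup>+x. ennreal (exp (a * (\<mu> * x - \<mu>\<^sup>2 / 2))) \<partial>normal_law 0) =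
      ennreal (exp (a * (a - 1) * \<mu>\<^sup>2 / 2)) * (\<integral>\<^sup>+x. ennreal (exp ((a * \<mu>) * x - (a * \<mu>)\<^sup>2 / 2)) \<partial>normal_law 0)"
    by (subst nn_integral_cmult[symmetric]) (simp_all add: eq ennreal_mult)
  also have "(\<integral>\<^sup>+x. ennreal (exp ((a * \<mu>) * x - (a * \<mu>)\<^sup>2 / 2)) \<partial>normal_law 0) =
      emeasure (density (normal_law 0) (\<lambda>x. ennreal (exp ((a * \<mu>) * x - (a * \<mu>)\<^sup>2 / 2)))) (space (normal_law 0))"
    by (subst emeasure_density) (auto intro!: nn_integral_cong)
  also have "\<dots> = 1"
    unfolding density_normal_law
    using prob_space.emeasure_space_1[OF prob_space_normal_law[of "a * \<mu>"]] by simp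
  finally show ?thesis by simp
qed

section \<open>Events of the filtration and the change of measure on them\<close>

lemma space_obs_filtration [simp]: "space (obs_filtration N t) = space (null_law N)"
  unfolding obs_filtration_def Let_def by (auto intro!: space_measure_of)

lemma sets_obs_filtration:
  "sets (obs_filtration N t) = sigma_sets (space (null_law N))
     {{\<omega> \<in> space (null_law N). \<omega> i \<in> B} | i B. i \<in> {(n, u). n \<in> {1..N} \<and> 1 \<le> u \<and> enat u \<le> t} \<and> B \<in> sets borel}"
proof -
  have "{{\<omega> \<in> space (null_law N). \<omega> (n, u) \<in> B} | n u B.
            n \<in> {1..N} \<and> 1 \<le> u \<and> enat u \<le> t \<and> B \<in> sets borel} =
     {{\<omega> \<in> space (null_law N). \<omega> i \<in> B} | i B. i \<in> {(n, u). n \<in> {1..N} \<and> 1 \<le> u \<and> enat u \<le> t} \<and> B \<in> sets borel}"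
    by fastforce
  then show ?thesis
    unfolding obs_filtration_def Let_def by (subst sets_measure_of) auto
qed

lemma sets_obs_filtration_subset: "sets (obs_filtration N t) \<subseteq> sets (null_law N)"
  unfolding sets_obs_filtration
proof (rule sets.sigma_sets_subset, safe)
  fix n u :: nat and B :: "real set"
  assume "n \<in> {1..N}" "1 \<le> u" "B \<in> sets borel"
  then have "(n, u) \<in> {1..N} \<times> {1..}" "B \<in> sets (normal_law 0)" by auto
  then show "{\<omega> \<in> space (null_law N). \<omega> (n, u) \<in> B} \<in> sets (null_law N)"
    unfolding null_law_def by measurable
qed

lemma sets_obs_filtration_mono: "s \<le> t \<Longrightarrow> sets (obs_filtration N s) \<subseteq> sets (obs_filtration N t)"
  unfolding sets_obs_filtration by (rule sigma_sets_mono') (auto intro: order_trans)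

lemma obs_filtration_restrict:
  assumes E: "E \<in> sets (obs_filtration N (enat t))"
  shows "\<exists>E'\<in>sets (\<Pi>\<^sub>M i \<in> {1..N} \<times> {1..t}. (borel :: real measure)).
    E = {\<omega> \<in> space (null_law N). restrict \<omega> ({1..N} \<times> {1..t}) \<in> E'}"
proof -
  have *: "{(n, u). n \<in> {1..N} \<and> 1 \<le> u \<and> enat u \<le> enat t} = {1..N} \<times> {1..t}" by auto
  have s: "sets (Pi\<^sub>M ({1..N} \<times> {1..t}) (\<lambda>i. normal_law 0)) = sets (\<Pi>\<^sub>M i \<in> {1..N} \<times> {1..t}. (borel :: real measure))"
    by (intro sets_PiM_cong) auto
  have J: "{1..N} \<times> {1..t} \<subseteq> {1..N} \<times> {1..}" by auto
  have "E \<in> sigma_sets (space (null_law N))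
      {{\<omega> \<in> space (null_law N). \<omega> i \<in> B} | i B. i \<in> {1..N} \<times> {1..t} \<and> B \<in> sets (normal_law 0)}"
    using E unfolding sets_obs_filtration * by simp
  from sigma_sets_coordinates_restrict[OF J this[unfolded null_law_def]]
  show ?thesis unfolding s null_law_def .
qed

text \<open>An event decided by time \<open>t\<close> sees only the finite block of coordinates up
  to \<open>t\<close>. Hence laws may be altered freely after \<open>t\<close>, both before the
  change and at the end of a window.\<close>

lemma emeasure_obs_filtration_cong:
  assumes M: "\<And>i. prob_space (M i)" "\<And>i. sets (M i) = sets borel"
    and M': "\<And>i. prob_space (M' i)" "\<And>i. sets (M' i) = sets borel"
    and eq: "\<And>n u. n \<in> {1..N} \<Longrightarrow> u \<in> {1..t} \<Longrightarrow> M (n, u) = M' (n, u)"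
    and E: "E \<in> sets (obs_filtration N (enat t))"
  shows "emeasure (PiM ({1..N} \<times> {1..}) M) E = emeasure (PiM ({1..N} \<times> {1..}) M') E"
proof -
  let ?I = "{1..N} \<times> {1::nat..}" and ?J = "{1..N} \<times> {1..t}"
  obtain E' where E': "E' \<in> sets (\<Pi>\<^sub>M i \<in> ?J. (borel :: real measure))"
      "E = {\<omega> \<in> space (null_law N). restrict \<omega> ?J \<in> E'}"
    using obs_filtration_restrict[OF E] by auto
  have *: "emeasure (PiM ?I M) E = emeasure (PiM ?J M) E'"
    if M: "\<And>i. prob_space (M i)" "\<And>i. sets (M i) = sets borel" for M :: "_ \<Rightarrow> real measure"
  proof -
    have "sets (PiM ?I M) = sets (null_law N)"
      unfolding null_law_def by (intro sets_PiM_cong) (auto simp: M)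
    then have sp: "space (null_law N) = space (PiM ?I M)" by (metis sets_eq_imp_space_eq)
    have s: "sets (PiM ?J M) = sets (\<Pi>\<^sub>M i \<in> ?J. (borel :: real measure))"
      by (intro sets_PiM_cong) (auto simp: M)
    show ?thesis unfolding E'(2) sp
      by (rule emeasure_PiM_restrict[OF M(1)]) (use E' s in auto)
  qed
  have "PiM ?J M = PiM ?J M'" using eq by (intro PiM_cong) auto
  then show ?thesis using *[of M] *[of M'] M M' by simp
qed

lemma cond_law_before_change:
  assumes "t < \<nu>" and "E \<in> sets (obs_filtration N (enat t))"
  shows "emeasure (cond_law N \<mu> \<nu> A) E = emeasure (null_law N) E"
  unfolding cond_law_def null_law_def
  by (rule emeasure_obs_filtration_cong[OF _ _ _ _ _ assms(2)])
    (use assms in \<open>auto simp: prob_space_normal_law signal_mean_def split: prod.split\<close>)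

text \<open>The likelihood ratio of mean \<mu> against mean 0 for stream \<open>n\<close> over the
  \<open>m\<close> times from \<nu> to \<open>\<nu> + m - 1\<close>.\<close>

definition window_lr :: "real \<Rightarrow> nat \<Rightarrow> nat \<Rightarrow> nat \<Rightarrow> path \<Rightarrow> real" where
  "window_lr \<mu> \<nu> m n \<omega> = (\<Prod>t\<in>{\<nu>..<\<nu> + m}. exp (\<mu> * \<omega> (n, t) - \<mu>\<^sup>2 / 2))"

lemma window_lr_pos: "0 < window_lr \<mu> \<nu> m n \<omega>"
  by (simp add: window_lr_def prod_pos)

lemma borel_measurable_window_lr:
  assumes [measurable]: "\<And>t. t \<in> {\<nu>..<\<nu> + m} \<Longrightarrow> (\<lambda>\<omega>. \<omega> (n, t)) \<in> borel_measurable M"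
  shows "window_lr \<mu> \<nu> m n \<in> borel_measurable M"
  unfolding window_lr_def[abs_def]
  by (intro borel_measurable_prod) measurable

lemma measurable_coordinate:
  "n \<in> {1..N} \<Longrightarrow> 1 \<le> t \<Longrightarrow> (\<lambda>\<omega>. \<omega> (n, t)) \<in> borel_measurable (null_law N)"
  unfolding null_law_def
  by (subst measurable_cong_sets[OF refl sets_normal_law[symmetric]])
     (rule measurable_component_singleton, auto)

lemma measurable_window_lr:
  "n \<in> {1..N} \<Longrightarrow> 1 \<le> \<nu> \<Longrightarrow> window_lr \<mu> \<nu> m n \<in> borel_measurable (null_law N)"
  by (rule borel_measurable_window_lr) (rule measurable_coordinate, auto)

text \<open>The conditional law shifts every time from \<nu> on, but an event decided by the end of
  the window cannot distinguish it from the law shifted inside the window only. That law tilts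
  finitely many coordinates and so has a density.\<close>

lemma cond_law_density:
  assumes A: "A \<subseteq> {1..N}" and \<nu>: "1 \<le> \<nu>" and E: "E \<in> sets (obs_filtration N (enat (\<nu> + m - 1)))"
  shows "emeasure (cond_law N \<mu> \<nu> A) E =
    (\<integral>\<^sup>+\<omega>. ennreal (\<Prod>n\<in>A. window_lr \<mu> \<nu> m n \<omega>) * indicator E \<omega> \<partial>null_law N)"
proof -
  let ?I = "{1..N} \<times> {1::nat..}" and ?W = "A \<times> {\<nu>..<\<nu> + m}"
  let ?f = "\<lambda>x::real. ennreal (exp (\<mu> * x - \<mu>\<^sup>2 / 2))"
  let ?M' = "\<lambda>i. if i \<in> ?W then density (normal_law 0) ?f else normal_law 0"
  have finA: "finite A" using A finite_subset by blast
  have EN: "E \<in> sets (null_law N)" using E sets_obs_filtration_subset by blast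
  have "emeasure (cond_law N \<mu> \<nu> A) E = emeasure (PiM ?I ?M') E"
    unfolding cond_law_def
    by (rule emeasure_obs_filtration_cong[OF _ _ _ _ _ E])
      (use \<nu> in \<open>auto simp: prob_space_normal_law signal_mean_def density_normal_law split: prod.split\<close>)
  also have "PiM ?I ?M' = density (null_law N) (\<lambda>\<omega>. \<Prod>i\<in>?W. ?f (\<omega> i))"
    unfolding null_law_def
    by (rule PiM_density_finite[symmetric])
      (use A \<nu> finA in \<open>auto simp: prob_space_normal_law density_normal_law\<close>)
  also have "(\<lambda>\<omega>. \<Prod>i\<in>?W. ?f (\<omega> i)) = (\<lambda>\<omega>. ennreal (\<Prod>n\<in>A. window_lr \<mu> \<nu> m n \<omega>))"
    unfolding window_lr_def prod.cartesian_product by (auto simp: prod_ennreal split_beta)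
  also have "emeasure (density (null_law N) \<dots>) E =
     (\<integral>\<^sup>+\<omega>. ennreal (\<Prod>n\<in>A. window_lr \<mu> \<nu> m n \<omega>) * indicator E \<omega> \<partial>null_law N)"
    using EN A \<nu>
    by (intro emeasure_density measurable_compose[OF _ measurable_ennreal] borel_measurable_prod measurable_window_lr) auto
  finally show ?thesis .
qed

text \<open>The \<open>m\<close> observations are independent, so the moment is the
  \<open>m\<close>-th power of the one for a single observation.\<close>

lemma nn_integral_window_lr_powr:
  assumes n: "n \<in> {1..N}" and \<nu>: "1 \<le> \<nu>"
  shows "(\<integral>\<^sup>+\<omega>. ennreal (window_lr \<mu> \<nu> m n \<omega> powr a) \<partial>null_law N) =
    ennreal (exp (a * (a - 1) * (m * \<mu>\<^sup>2 / 2)))"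
proof -
  let ?W = "{n} \<times> {\<nu>..<\<nu> + m}"
  have "(\<integral>\<^sup>+\<omega>. ennreal (window_lr \<mu> \<nu> m n \<omega> powr a) \<partial>null_law N) =
      (\<integral>\<^sup>+\<omega>. (\<Prod>i\<in>?W. ennreal (exp (a * (\<mu> * \<omega> i - \<mu>\<^sup>2 / 2)))) \<partial>null_law N)"
  proof (rule nn_integral_cong)
    fix \<omega>
    have "window_lr \<mu> \<nu> m n \<omega> = exp (\<Sum>t\<in>{\<nu>..<\<nu> + m}. \<mu> * \<omega> (n, t) - \<mu>\<^sup>2 / 2)"
      by (simp add: window_lr_def exp_sum)
    then have "window_lr \<mu> \<nu> m n \<omega> powr a = exp (\<Sum>t\<in>{\<nu>..<\<nu> + m}. a * (\<mu> * \<omega> (n, t) - \<mu>\<^sup>2 / 2))"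
      by (simp add: powr_def sum_distrib_left)
    also have "\<dots> = (\<Prod>i\<in>?W. exp (a * (\<mu> * \<omega> i - \<mu>\<^sup>2 / 2)))"
      by (simp add: exp_sum prod.cartesian_product[symmetric, of "\<lambda>n t. exp (a * (\<mu> * \<omega> (n, t) - \<mu>\<^sup>2 / 2))", simplified split_def prod.collapse])
    finally show "ennreal (window_lr \<mu> \<nu> m n \<omega> powr a) = (\<Prod>i\<in>?W. ennreal (exp (a * (\<mu> * \<omega> i - \<mu>\<^sup>2 / 2))))"
      by (simp add: prod_ennreal)
  qed
  also have "\<dots> = (\<Prod>i\<in>?W. \<integral>\<^sup>+x. ennreal (exp (a * (\<mu> * x - \<mu>\<^sup>2 / 2))) \<partial>normal_law 0)"
    unfolding null_law_def
    by (rule nn_integral_PiM_prod) (use n \<nu> in \<open>auto simp: prob_space_normal_law\<close>)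
  also have "\<dots> = ennreal (exp (a * (a - 1) * \<mu>\<^sup>2 / 2) ^ m)"
    by (simp add: nn_integral_exp_normal_law ennreal_power)
  also have "exp (a * (a - 1) * \<mu>\<^sup>2 / 2) ^ m = exp (a * (a - 1) * (m * \<mu>\<^sup>2 / 2))"
    by (simp add: exp_of_nat_mult[symmetric] mult.commute mult.left_commute)
  finally show ?thesis .
qed

lemma stopped_sets_obs_filtration:
  assumes "stopping_rule N T"
  shows "{\<omega> \<in> space (null_law N). T \<omega> \<le> enat k} \<in> sets (obs_filtration N (enat k))"
  using stopping_timeD[of "obs_filtration N" T "enat k"] assms
  by (simp add: stopping_rule_def pred_def)

lemma not_stopped_Suc: "not_stopped N T (Suc k) = space (null_law N) - {\<omega> \<in> space (null_law N). T \<omega> \<le> enat k}"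
proof -
  have "enat (Suc k) \<le> T \<omega> \<longleftrightarrow> \<not> T \<omega> \<le> enat k" for \<omega>
    by (cases "T \<omega>") auto
  then show ?thesis by (auto simp: not_stopped_def)
qed

text \<open>\<open>T \<ge> \<nu>\<close> is the complement of stopping by \<open>\<nu> - 1\<close>,
  hence decided strictly before the change. This shift by one makes it independent of the window
  starting at \<nu>.\<close>

lemma not_stopped_sets_obs_filtration:
  assumes "stopping_rule N T" "1 \<le> \<nu>"
  shows "not_stopped N T \<nu> \<in> sets (obs_filtration N (enat (\<nu> - 1)))"
proof -
  obtain k where "\<nu> = Suc k" using assms(2) by (cases \<nu>) auto
  then show ?thesis
    using sets.compl_sets[OF stopped_sets_obs_filtration[OF assms(1), of k]] by (simp add: not_stopped_Suc)
qed

lemma not_stopped_sets_null_law: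
  assumes "stopping_rule N T" "1 \<le> \<nu>"
  shows "not_stopped N T \<nu> \<in> sets (null_law N)"
  using not_stopped_sets_obs_filtration[OF assms] sets_obs_filtration_subset by blast

lemma not_stopped_antimono: "\<nu> \<le> \<nu>' \<Longrightarrow> not_stopped N T \<nu>' \<subseteq> not_stopped N T \<nu>"
  by (auto simp: not_stopped_def intro: order_trans[of "enat \<nu>" "enat \<nu>'"])

lemma stopped_in_window_sets:
  assumes "stopping_rule N T" "1 \<le> \<nu>"
  shows "not_stopped N T \<nu> - not_stopped N T (\<nu> + m) \<in> sets (obs_filtration N (enat (\<nu> + m - 1)))"
proof (rule sets.Diff)
  show "not_stopped N T \<nu> \<in> sets (obs_filtration N (enat (\<nu> + m - 1)))"
    using not_stopped_sets_obs_filtration[OF assms] sets_obs_filtration_mono[of "enat (\<nu> - 1)" "enat (\<nu> + m - 1)" N] assms(2)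
    by (meson add_leD1 diff_le_mono enat_ord_simps(1) le_add1 subsetD)
  show "not_stopped N T (\<nu> + m) \<in> sets (obs_filtration N (enat (\<nu> + m - 1)))"
    by (rule not_stopped_sets_obs_filtration) (use assms in auto)
qed

text \<open>The past up to \<open>\<nu> - 1\<close> and the windows of the different streams are
  disjoint blocks of coordinates, hence independent.\<close>

lemma nn_integral_past_window:
  fixes h :: "real \<Rightarrow> ennreal"
  assumes \<nu>: "1 \<le> \<nu>" and E: "E \<in> sets (obs_filtration N (enat (\<nu> - 1)))"
    and h [measurable]: "h \<in> borel_measurable borel" and B: "B \<subseteq> {1..N}"
  shows "(\<integral>\<^sup>+\<omega>. indicator E \<omega> * (\<Prod>n\<in>B. h (window_lr \<mu> \<nu> m n \<omega>)) \<partial>null_law N) =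
    emeasure (null_law N) E * (\<Prod>n\<in>B. \<integral>\<^sup>+\<omega>. h (window_lr \<mu> \<nu> m n \<omega>) \<partial>null_law N)"
proof -
  interpret P: prob_space "null_law N" by (rule prob_space_null_law)
  let ?J = "{1..N} \<times> {1..\<nu> - 1}"
  obtain E' where E': "E' \<in> sets (\<Pi>\<^sub>M i \<in> ?J. (borel :: real measure))"
      "E = {\<omega> \<in> space (null_law N). restrict \<omega> ?J \<in> E'}"
    using obs_filtration_restrict[OF E] by auto
  have [measurable]: "E' \<in> sets (\<Pi>\<^sub>M i \<in> ?J. normal_law 0)"
    using E'(1) sets_PiM_cong[of ?J ?J "\<lambda>_. normal_law 0" "\<lambda>_. borel"] by simp
  have EN: "E \<in> sets (null_law N)" using E sets_obs_filtration_subset by blast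
  have finB: "finite B" and 0: "0 \<notin> B" using B finite_subset by auto
  \<comment> \<open>Streams are numbered from 1, so index 0 is free to label the block of the
    past.\<close>
  define K where "K n = (if n = 0 then ?J else {n} \<times> {\<nu>..<\<nu> + m})" for n
  define Y where "Y n = (if n = 0 then indicator E' else (\<lambda>\<omega>. h (window_lr \<mu> \<nu> m n \<omega>)))" for n
  have "P.indep_vars (\<lambda>_. normal_law 0) (\<lambda>i \<omega>. \<omega> i) ({1..N} \<times> {1..})"
    unfolding null_law_def by (rule indep_vars_PiM_coordinates) (rule prob_space_normal_law)
  then have "P.indep_vars (\<lambda>n. \<Pi>\<^sub>M i\<in>K n. normal_law 0) (\<lambda>n \<omega>. restrict (\<lambda>i. \<omega> i) (K n)) (insert 0 B)"
    by (rule P.indep_vars_restrict) (use B \<nu> in \<open>auto simp: K_def disjoint_family_on_def\<close>)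
  then have "P.indep_vars (\<lambda>_. borel) (\<lambda>n \<omega>. Y n (restrict \<omega> (K n))) (insert 0 B)"
  proof (rule P.indep_vars_compose2)
    fix n assume "n \<in> insert 0 B"
    show "Y n \<in> borel_measurable (\<Pi>\<^sub>M i\<in>K n. normal_law 0)"
    proof (cases "n = 0")
      case True then show ?thesis by (simp add: Y_def K_def del: One_nat_def)
    next
      case False
      have "(\<lambda>\<omega>. \<omega> (n, t)) \<in> borel_measurable (\<Pi>\<^sub>M i\<in>K n. normal_law 0)" if "t \<in> {\<nu>..<\<nu> + m}" for t
        using measurable_component_singleton[of "(n, t)" "K n" "\<lambda>_. normal_law 0"] that False
        by (simp add: K_def measurable_cong_sets[OF refl sets_normal_law])
      then have "window_lr \<mu> \<nu> m n \<in> borel_measurable (\<Pi>\<^sub>M i\<in>K n. normal_law 0)"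
        by (rule borel_measurable_window_lr)
      then show ?thesis using False by (simp add: Y_def)
    qed
  qed
  then have "(\<integral>\<^sup>+\<omega>. (\<Prod>n\<in>insert 0 B. Y n (restrict \<omega> (K n))) \<partial>null_law N) =
      (\<Prod>n\<in>insert 0 B. \<integral>\<^sup>+\<omega>. Y n (restrict \<omega> (K n)) \<partial>null_law N)"
    using finB by (intro P.indep_vars_nn_integral) auto
  also have "\<dots> = (\<integral>\<^sup>+\<omega>. Y 0 (restrict \<omega> (K 0)) \<partial>null_law N) *
      (\<Prod>n\<in>B. \<integral>\<^sup>+\<omega>. Y n (restrict \<omega> (K n)) \<partial>null_law N)"
    using finB 0 by simp
  also have "(\<integral>\<^sup>+\<omega>. Y 0 (restrict \<omega> (K 0)) \<partial>null_law N) = (\<integral>\<^sup>+\<omega>. indicator E \<omega> \<partial>null_law N)"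
    by (intro nn_integral_cong) (simp add: Y_def K_def E'(2) indicator_def)
  also have "\<dots> = emeasure (null_law N) E" using EN by simp
  \<comment> \<open>The likelihood ratio of stream \<open>n\<close> reads only the coordinates of
    its own block, so restricting to the block leaves it unchanged.\<close>
  also have *: "Y n (restrict \<omega> (K n)) = h (window_lr \<mu> \<nu> m n \<omega>)" if "n \<in> B" for n \<omega>
    using that 0 by (cases "n = 0") (auto simp: Y_def K_def window_lr_def intro!: arg_cong[of _ _ h] prod.cong)
  then have "(\<Prod>n\<in>B. \<integral>\<^sup>+\<omega>. Y n (restrict \<omega> (K n)) \<partial>null_law N) =
      (\<Prod>n\<in>B. \<integral>\<^sup>+\<omega>. h (window_lr \<mu> \<nu> m n \<omega>) \<partial>null_law N)" by simp
  also have "(\<integral>\<^sup>+\<omega>. (\<Prod>n\<in>insert 0 B. Y n (restrict \<omega> (K n))) \<partial>null_law N) =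
     (\<integral>\<^sup>+\<omega>. indicator E \<omega> * (\<Prod>n\<in>B. h (window_lr \<mu> \<nu> m n \<omega>)) \<partial>null_law N)"
  proof (rule nn_integral_cong)
    fix \<omega> assume "\<omega> \<in> space (null_law N)"
    then have "Y 0 (restrict \<omega> (K 0)) = indicator E \<omega>" by (simp add: Y_def K_def E'(2) indicator_def)
    then show "(\<Prod>n\<in>insert 0 B. Y n (restrict \<omega> (K n))) = indicator E \<omega> * (\<Prod>n\<in>B. h (window_lr \<mu> \<nu> m n \<omega>))"
      using finB 0 * by simp
  qed
  finally show ?thesis .
qed

section \<open>Averaging over the random affected set\<close>

lemma emeasure_change_law:
  assumes "E \<in> sets (null_law N)"
  shows "emeasure (change_law N p \<mu> \<nu>) E = (\<integral>\<^sup>+A. emeasure (cond_law N \<mu> \<nu> A) E \<partial>affected_pmf N p)"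
  unfolding change_law_def
  by (rule emeasure_bind_prob_algebra[OF _ cond_law_measurable assms])
     (simp add: space_prob_algebra prob_space_measure_pmf)

lemma affected_pmf_subset: "A \<in> set_pmf (affected_pmf N p) \<Longrightarrow> A \<subseteq> {1..N}"
  by (auto simp: affected_pmf_def)

lemma finite_set_affected_pmf: "finite (set_pmf (affected_pmf N p))"
  by (rule finite_subset[of _ "Pow {1..N}"]) (use affected_pmf_subset in blast, simp)

text \<open>Every conditional law agrees with the null law before \<nu>, hence so does their
  mixture. In particular \<open>T \<ge> \<nu>\<close> has the same probability under both, which
  lets bounds relative to this event pass from one law to the other.\<close>

lemma change_law_before_change:
  assumes "t < \<nu>" and E: "E \<in> sets (obs_filtration N (enat t))"
  shows "emeasure (change_law N p \<mu> \<nu>) E = emeasure (null_law N) E"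
proof -
  have "E \<in> sets (null_law N)" using E sets_obs_filtration_subset by blast
  then show ?thesis using assms
    by (simp add: emeasure_change_law cond_law_before_change measure_pmf.emeasure_space_1[simplified])
qed

text \<open>Writing the product over all streams with factor 1 for the unaffected ones, independence
  of the memberships factorises the average over subsets.\<close>

lemma nn_integral_affected_pmf_prod:
  fixes f :: "nat \<Rightarrow> real"
  assumes p: "0 \<le> p" "p \<le> 1" and f: "\<And>n. n \<in> {1..N} \<Longrightarrow> 0 \<le> f n"
  shows "(\<integral>\<^sup>+A. ennreal (\<Prod>n\<in>A. f n) \<partial>affected_pmf N p) = ennreal (\<Prod>n\<in>{1..N}. 1 - p + p * f n)"
proof -
  have *: "ennreal (\<Prod>n\<in>{n \<in> {1..N}. b n}. f n) = (\<Prod>n\<in>{1..N}. if b n then ennreal (f n) else 1)" for b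
  proof -
    have "(\<Prod>n\<in>{n \<in> {1..N}. b n}. f n) = (\<Prod>n\<in>{1..N}. if b n then f n else 1)"
      by (rule prod.inter_filter) simp
    also have "ennreal \<dots> = (\<Prod>n\<in>{1..N}. ennreal (if b n then f n else 1))"
      using f by (intro prod_ennreal[symmetric]) simp
    finally show ?thesis by (simp add: if_distrib[of ennreal] cong: if_cong)
  qed
  have "(\<integral>\<^sup>+A. ennreal (\<Prod>n\<in>A. f n) \<partial>affected_pmf N p) =
      (\<integral>\<^sup>+b. (\<Prod>n\<in>{1..N}. if b n then ennreal (f n) else 1) \<partial>Pi_pmf {1..N} False (\<lambda>_. bernoulli_pmf p))"
    unfolding affected_pmf_def by (simp only: nn_integral_map_pmf *)
  also have "\<dots> = (\<Prod>n\<in>{1..N}. \<integral>\<^sup>+c. (if c then ennreal (f n) else 1) \<partial>bernoulli_pmf p)"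
    by (rule nn_integral_prod_Pi_pmf) simp
  also have "\<dots> = (\<Prod>n\<in>{1..N}. ennreal (1 - p + p * f n))"
    using p f by (intro prod.cong refl) (simp add: ennreal_mult[symmetric] ennreal_plus[symmetric] algebra_simps del: ennreal_plus)
  also have "\<dots> = ennreal (\<Prod>n\<in>{1..N}. 1 - p + p * f n)"
    using p f by (intro prod_ennreal) simp
  finally show ?thesis .
qed

text \<open>There are finitely many affected sets, so their average can be exchanged with the
  integral over paths; averaging the conditional densities then gives a product over
  streams.\<close>

lemma change_law_density:
  assumes p: "0 \<le> p" "p \<le> 1" and \<nu>: "1 \<le> \<nu>" and E: "E \<in> sets (obs_filtration N (enat (\<nu> + m - 1)))"
  shows "emeasure (change_law N p \<mu> \<nu>) E =
    (\<integral>\<^sup>+\<omega>. ennreal (\<Prod>n\<in>{1..N}. 1 - p + p * window_lr \<mu> \<nu> m n \<omega>) * indicator E \<omega> \<partial>null_law N)"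
proof -
  let ?S = "set_pmf (affected_pmf N p)"
  let ?g = "\<lambda>A \<omega>. ennreal (\<Prod>n\<in>A. window_lr \<mu> \<nu> m n \<omega>)"
  have EN [measurable]: "E \<in> sets (null_law N)" using E sets_obs_filtration_subset by blast
  have [measurable]: "?g A \<in> borel_measurable (null_law N)" if "A \<in> ?S" for A
    using affected_pmf_subset[OF that] \<nu>
    by (intro measurable_compose[OF _ measurable_ennreal] borel_measurable_prod measurable_window_lr) auto
  have "emeasure (change_law N p \<mu> \<nu>) E = (\<Sum>A\<in>?S. emeasure (cond_law N \<mu> \<nu> A) E * pmf (affected_pmf N p) A)"
    by (simp add: emeasure_change_law[OF EN] nn_integral_measure_pmf_finite finite_set_affected_pmf)
  also have "\<dots> = (\<Sum>A\<in>?S. \<integral>\<^sup>+\<omega>. ?g A \<omega> * indicator E \<omega> * pmf (affected_pmf N p) A \<partial>null_law N)"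
    by (intro sum.cong refl) (simp add: cond_law_density[OF affected_pmf_subset \<nu> E] nn_integral_multc)
  also have "\<dots> = (\<integral>\<^sup>+\<omega>. (\<Sum>A\<in>?S. ?g A \<omega> * indicator E \<omega> * pmf (affected_pmf N p) A) \<partial>null_law N)"
    by (rule nn_integral_sum[symmetric]) measurable
  also have "\<dots> = (\<integral>\<^sup>+\<omega>. (\<Sum>A\<in>?S. ?g A \<omega> * pmf (affected_pmf N p) A) * indicator E \<omega> \<partial>null_law N)"
    by (simp add: sum_distrib_left sum_distrib_right mult_ac)
  also have "\<dots> = (\<integral>\<^sup>+\<omega>. (\<integral>\<^sup>+A. ?g A \<omega> \<partial>affected_pmf N p) * indicator E \<omega> \<partial>null_law N)"
    by (simp add: nn_integral_measure_pmf_finite finite_set_affected_pmf)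
  also have "\<dots> = (\<integral>\<^sup>+\<omega>. ennreal (\<Prod>n\<in>{1..N}. 1 - p + p * window_lr \<mu> \<nu> m n \<omega>) * indicator E \<omega> \<partial>null_law N)"
    using p by (subst nn_integral_affected_pmf_prod) (auto simp: less_imp_le[OF window_lr_pos])
  finally show ?thesis .
qed

text \<open>Linearity of expectation; serves the Markov bound on large affected sets.\<close>

lemma nn_integral_affected_pmf_card:
  assumes p: "0 \<le> p" "p \<le> 1"
  shows "(\<integral>\<^sup>+A. ennreal (real (card A)) \<partial>measure_pmf (affected_pmf N p)) = ennreal (real N * p)"
proof -
  have *: "ennreal (card {n \<in> {1..N}. b n}) = (\<Sum>n\<in>{1..N}. indicator {b. b n} b)" for b :: "nat \<Rightarrow> bool"
  proof -
    have "real (card {n \<in> {1..N}. b n}) = (\<Sum>n\<in>{1..N}. indicator {b. b n} b)"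
      by (simp add: indicator_def Int_def)
    then show ?thesis by (simp add: ennreal_indicator sum_ennreal[symmetric] del: sum_ennreal)
  qed
  have "(\<integral>\<^sup>+A. ennreal (real (card A)) \<partial>measure_pmf (affected_pmf N p)) =
      (\<integral>\<^sup>+b. (\<Sum>n\<in>{1..N}. indicator {b. b n} b) \<partial>Pi_pmf {1..N} False (\<lambda>_. bernoulli_pmf p))"
    unfolding affected_pmf_def by (simp only: nn_integral_map_pmf *)
  also have "\<dots> = (\<Sum>n\<in>{1..N}. emeasure (Pi_pmf {1..N} False (\<lambda>_. bernoulli_pmf p)) {b. b n})"
    by (subst nn_integral_sum) auto
  also have "\<dots> = (\<Sum>n\<in>{1..N}. ennreal p)"
  proof (rule sum.cong[OF refl])
    fix n assume n: "n \<in> {1..N}"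
    have "emeasure (Pi_pmf {1..N} False (\<lambda>_. bernoulli_pmf p)) {b. b n} =
        emeasure (map_pmf (\<lambda>b. b n) (Pi_pmf {1..N} False (\<lambda>_. bernoulli_pmf p))) {True}"
      by (simp add: vimage_def)
    also have "\<dots> = ennreal p"
      using n p by (subst Pi_pmf_component) (auto simp: emeasure_pmf_single)
    finally show "emeasure (Pi_pmf {1..N} False (\<lambda>_. bernoulli_pmf p)) {b. b n} = ennreal p" .
  qed
  also have "\<dots> = ennreal (real N * p)" using p by (simp add: ennreal_mult ennreal_of_nat_eq_real_of_nat)
  finally show ?thesis .
qed

subsection \<open>Moment bounds for the change of measure\<close>

text \<open>The weights \<open>1 / (1 + y)\<close> and \<open>y / (1 + y)\<close> sum to 1 and lie
  in the unit interval, where raising to a power \<open>s \<le> 1\<close> does not decrease a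
  number.\<close>

lemma powr_add_le_one_add:
  fixes s y :: real
  assumes s: "0 \<le> s" "s \<le> 1" and y: "0 \<le> y"
  shows "(1 + y) powr s \<le> 1 + y powr s"
proof -
  have le: "x / (1 + y) \<le> (x / (1 + y)) powr s" if "0 \<le> x" "x \<le> 1 + y" for x
    using powr_mono'[of s 1 "x / (1 + y)"] that s y by (simp add: field_simps)
  have "(1 + y) powr s = (1 / (1 + y) + y / (1 + y)) * (1 + y) powr s"
    using y by (simp add: field_simps)
  also have "\<dots> \<le> ((1 / (1 + y)) powr s + (y / (1 + y)) powr s) * (1 + y) powr s"
    using le[of 1] le[of y] y by (intro mult_right_mono add_mono) auto
  also have "\<dots> = 1 + y powr s"
    using y by (simp add: powr_divide field_simps)
  finally show ?thesis .
qed

text \<open>The constant term and the coefficient of \<open>x\<close> add up to \<open>1\<close>: when \<open>x\<close> is a likelihood ratio,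
  hence has mean \<open>1\<close>, only the last term contributes to the excess of the moment over \<open>1\<close>.\<close>

lemma mixture_powr_le:
  fixes p s x :: real
  assumes p: "0 \<le> p" "p \<le> 1" and s: "0 \<le> s" "s \<le> 1" and x: "0 < x"
  shows "(1 - p + p * x) powr (1 + s) \<le>
    (1 - p) * (1 - s * p) + ((1 - p) * s * p + p) * x + p powr (1 + s) * x powr (1 + s)"
proof -
  define l where "l = 1 - p + p * x"
  have l: "0 < l"
    using p x unfolding l_def by (cases "p = 1") (auto intro: add_pos_nonneg)
  \<comment> \<open>Weighted arithmetic-geometric mean of \<open>l\<close> and 1: the tangent to the
    concave function \<open>l powr s\<close> at 1.\<close>
  have "l powr s * 1 powr (1 - s) \<le> s * l + (1 - s) * 1"
    using s l by (intro Youngs_inequality_0) auto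
  then have 1: "l powr s \<le> 1 - s + s * l" by simp
  have "l powr s \<le> (1 + p * x) powr s"
    using p x s l unfolding l_def by (intro powr_mono2) auto
  also have "\<dots> \<le> 1 + (p * x) powr s"
    using p x s by (intro powr_add_le_one_add) auto
  finally have 2: "l powr s \<le> 1 + (p * x) powr s" .
  \<comment> \<open>One factor \<open>l\<close> is split into its two summands. The tangent bound
    serves the first; subadditivity there would leave a term in \<open>p powr s * x powr s\<close>
    in place of one of order \<open>1 + s\<close>.\<close>
  have "l powr (1 + s) = (1 - p) * l powr s + p * x * l powr s"
    using l by (simp add: powr_add l_def algebra_simps)
  also have "\<dots> \<le> (1 - p) * (1 - s + s * l) + p * x * (1 + (p * x) powr s)"
    using 1 2 p x by (intro add_mono mult_left_mono) auto
  also have "\<dots> = (1 - p) * (1 - s * p) + ((1 - p) * s * p + p) * x + p powr (1 + s) * x powr (1 + s)"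
    using p x by (simp add: l_def powr_add powr_mult algebra_simps)
  finally show ?thesis by (simp add: l_def)
qed

lemma nn_integral_mixture_powr_le:
  assumes n: "n \<in> {1..N}" and \<nu>: "1 \<le> \<nu>" and p: "0 \<le> p" "p \<le> 1" and s: "0 \<le> s" "s \<le> 1"
  shows "(\<integral>\<^sup>+\<omega>. ennreal ((1 - p + p * window_lr \<mu> \<nu> m n \<omega>) powr (1 + s)) \<partial>null_law N) \<le>
    ennreal (1 + p powr (1 + s) * exp (s * (1 + s) * (m * \<mu>\<^sup>2 / 2)))"
proof -
  interpret P: prob_space "null_law N" by (rule prob_space_null_law)
  let ?x = "window_lr \<mu> \<nu> m n"
  let ?a = "(1 - p) * (1 - s * p)" and ?b = "(1 - p) * s * p + p" and ?d = "p powr (1 + s)"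
  have [measurable]: "?x \<in> borel_measurable (null_law N)" using n \<nu> by (rule measurable_window_lr)
  have "s * p \<le> 1" using p s by (simp add: mult_le_one)
  then have a: "0 \<le> ?a" and b: "0 \<le> ?b" using p s by auto
  have "(\<integral>\<^sup>+\<omega>. ennreal ((1 - p + p * ?x \<omega>) powr (1 + s)) \<partial>null_law N) \<le>
      (\<integral>\<^sup>+\<omega>. ennreal ?a + ennreal ?b * ennreal (?x \<omega> powr 1) + ennreal ?d * ennreal (?x \<omega> powr (1 + s)) \<partial>null_law N)"
  proof (rule nn_integral_mono)
    fix \<omega>
    show "ennreal ((1 - p + p * ?x \<omega>) powr (1 + s)) \<le>
        ennreal ?a + ennreal ?b * ennreal (?x \<omega> powr 1) + ennreal ?d * ennreal (?x \<omega> powr (1 + s))"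
      using mixture_powr_le[OF p s window_lr_pos] a b less_imp_le[OF window_lr_pos]
      by (simp add: ennreal_mult[symmetric] ennreal_plus[symmetric] ennreal_leI del: ennreal_plus)
  qed
  also have "\<dots> = ennreal ?a + ennreal ?b * (\<integral>\<^sup>+\<omega>. ennreal (?x \<omega> powr 1) \<partial>null_law N) +
      ennreal ?d * (\<integral>\<^sup>+\<omega>. ennreal (?x \<omega> powr (1 + s)) \<partial>null_law N)"
    by (simp add: nn_integral_add nn_integral_cmult P.emeasure_space_1)
  also have "\<dots> = ennreal (?a + ?b * 1 + ?d * exp (s * (1 + s) * (m * \<mu>\<^sup>2 / 2)))"
    unfolding nn_integral_window_lr_powr[OF n \<nu>] using a b
    by (simp add: ennreal_mult[symmetric] ennreal_plus[symmetric] mult_ac del: ennreal_plus)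
  also have "?a + ?b * 1 = 1" by (simp add: algebra_simps)
  finally show ?thesis .
qed

text \<open>Uses \<open>L \<le> c + c\<^sup>-\<^sup>s L\<^sup>1\<^sup>+\<^sup>s\<close>, where the second term is integrated over the larger event
  \<open>F\<close>, which lies in the past of the window and is therefore independent of \<open>L\<close>.\<close>

lemma nn_integral_tilted_le:
  fixes k :: "real \<Rightarrow> real"
  assumes \<nu>: "1 \<le> \<nu>" and F: "F \<in> sets (obs_filtration N (enat (\<nu> - 1)))"
    and E: "E \<in> sets (null_law N)" "E \<subseteq> F"
    and q: "emeasure (null_law N) E \<le> q * emeasure (null_law N) F"
    and B: "B \<subseteq> {1..N}" and k [measurable]: "k \<in> borel_measurable borel" and k0: "\<And>x. 0 < x \<Longrightarrow> 0 < k x"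
    and M: "\<And>n. n \<in> B \<Longrightarrow>
      (\<integral>\<^sup>+\<omega>. ennreal (k (window_lr \<mu> \<nu> m n \<omega>) powr (1 + s)) \<partial>null_law N) \<le> M"
    and c: "0 < c" and s: "0 \<le> s"
  shows "(\<integral>\<^sup>+\<omega>. ennreal (\<Prod>n\<in>B. k (window_lr \<mu> \<nu> m n \<omega>)) * indicator E \<omega> \<partial>null_law N) \<le>
    (ennreal c * q + ennreal (c powr (- s)) * M ^ card B) * emeasure (null_law N) F"
proof -
  let ?k = "\<lambda>n \<omega>. k (window_lr \<mu> \<nu> m n \<omega>)"
  let ?L = "\<lambda>\<omega>. \<Prod>n\<in>B. ?k n \<omega>"
  have kpos: "0 < ?k n \<omega>" for n \<omega> by (intro k0 window_lr_pos)
  have [measurable]: "window_lr \<mu> \<nu> m n \<in> borel_measurable (null_law N)" if "n \<in> B" for n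
    using that B \<nu> by (intro measurable_window_lr) auto
  have FN: "F \<in> sets (null_law N)" using F sets_obs_filtration_subset by blast
  have le: "ennreal (?L \<omega>) * indicator E \<omega> \<le>
      ennreal c * indicator E \<omega> + ennreal (c powr (- s)) * (indicator F \<omega> * (\<Prod>n\<in>B. ennreal (?k n \<omega> powr (1 + s))))" for \<omega>
  proof (cases "\<omega> \<in> E")
    case True
    have Lpos: "0 < ?L \<omega>" using kpos by (intro prod_pos) auto
    have "?L \<omega> \<le> c + c powr (- s) * ?L \<omega> powr (1 + s)"
    proof (cases "?L \<omega> \<le> c")
      case True
      moreover have "0 \<le> c powr (- s) * ?L \<omega> powr (1 + s)" by simp
      ultimately show ?thesis by linarith
    next
      case False
      have "?L \<omega> = ?L \<omega> powr (- s) * ?L \<omega> powr (1 + s)"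
        using Lpos by (simp add: powr_add[symmetric])
      also have "\<dots> \<le> c powr (- s) * ?L \<omega> powr (1 + s)"
        using False c s by (intro mult_right_mono powr_mono2') auto
      finally show ?thesis using c by simp
    qed
    also have "?L \<omega> powr (1 + s) = (\<Prod>n\<in>B. ?k n \<omega> powr (1 + s))"
      by (rule prod_powr_distrib)
    finally have "ennreal (?L \<omega>) \<le> ennreal (c + c powr (- s) * (\<Prod>n\<in>B. ?k n \<omega> powr (1 + s)))"
      by (rule ennreal_leI)
    also have "\<dots> = ennreal c + ennreal (c powr (- s)) * (\<Prod>n\<in>B. ennreal (?k n \<omega> powr (1 + s)))"
      using c by (simp add: prod_ennreal prod_nonneg ennreal_mult)
    finally show ?thesis using True E(2) by (simp add: subset_iff)
  qed simp
  have "(\<integral>\<^sup>+\<omega>. ennreal (?L \<omega>) * indicator E \<omega> \<partial>null_law N) \<le>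
      (\<integral>\<^sup>+\<omega>. ennreal c * indicator E \<omega> + ennreal (c powr (- s)) * (indicator F \<omega> * (\<Prod>n\<in>B. ennreal (?k n \<omega> powr (1 + s)))) \<partial>null_law N)"
    by (intro nn_integral_mono le)
  also have "\<dots> = ennreal c * emeasure (null_law N) E + ennreal (c powr (- s)) *
      (\<integral>\<^sup>+\<omega>. indicator F \<omega> * (\<Prod>n\<in>B. ennreal (?k n \<omega> powr (1 + s))) \<partial>null_law N)"
    using E(1) FN by (simp add: nn_integral_add nn_integral_cmult)
  also have "(\<integral>\<^sup>+\<omega>. indicator F \<omega> * (\<Prod>n\<in>B. ennreal (?k n \<omega> powr (1 + s))) \<partial>null_law N) =
      emeasure (null_law N) F * (\<Prod>n\<in>B. \<integral>\<^sup>+\<omega>. ennreal (?k n \<omega> powr (1 + s)) \<partial>null_law N)"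
    by (rule nn_integral_past_window[OF \<nu> F _ B, where h = "\<lambda>x. ennreal (k x powr (1 + s))"]) measurable
  also have "ennreal c * emeasure (null_law N) E + ennreal (c powr (- s)) * \<dots> \<le>
      ennreal c * (q * emeasure (null_law N) F) + ennreal (c powr (- s)) * (emeasure (null_law N) F * M ^ card B)"
  proof (intro add_mono mult_left_mono)
    have "(\<Prod>n\<in>B. \<integral>\<^sup>+\<omega>. ennreal (?k n \<omega> powr (1 + s)) \<partial>null_law N) \<le> (\<Prod>n\<in>B. M)"
      using M by (intro prod_mono_ennreal)
    then show "(\<Prod>n\<in>B. \<integral>\<^sup>+\<omega>. ennreal (?k n \<omega> powr (1 + s)) \<partial>null_law N) \<le> M ^ card B" by simp
  qed (use q in auto)
  also have "\<dots> = (ennreal c * q + ennreal (c powr (- s)) * M ^ card B) * emeasure (null_law N) F"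
    by (simp add: algebra_simps)
  finally show ?thesis .
qed

text \<open>The dense regime: the affected set is averaged out first, and the moment of order
  \<open>1 + s\<close> is taken of the mixture density over all streams.\<close>

lemma change_law_stopped_le_mixture:
  assumes T: "stopping_rule N T" and \<nu>: "1 \<le> \<nu>" and p: "0 \<le> p" "p < 1" and s: "0 \<le> s" "s \<le> 1" and c: "0 < c"
    and q0: "0 \<le> q"
    and q: "emeasure (null_law N) (not_stopped N T \<nu> - not_stopped N T (\<nu> + m)) \<le>
      ennreal q * emeasure (null_law N) (not_stopped N T \<nu>)"
  shows "emeasure (change_law N p \<mu> \<nu>) (not_stopped N T \<nu> - not_stopped N T (\<nu> + m)) \<le>
    ennreal (c * q + c powr (- s) * (1 + p powr (1 + s) * exp (s * (1 + s) * (m * \<mu>\<^sup>2 / 2))) ^ N) *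
    emeasure (null_law N) (not_stopped N T \<nu>)" (is "_ \<le> ennreal (c * q + c powr (- s) * ?M ^ N) * _")
proof -
  let ?E = "not_stopped N T \<nu> - not_stopped N T (\<nu> + m)"
  note E = stopped_in_window_sets[OF T \<nu>, of m]
  have M0: "0 \<le> ?M" by (simp add: add_nonneg_nonneg)
  have "emeasure (change_law N p \<mu> \<nu>) ?E =
      (\<integral>\<^sup>+\<omega>. ennreal (\<Prod>n\<in>{1..N}. 1 - p + p * window_lr \<mu> \<nu> m n \<omega>) * indicator ?E \<omega> \<partial>null_law N)"
    using p \<nu> E by (intro change_law_density) auto
  also have "\<dots> \<le> (ennreal c * ennreal q + ennreal (c powr (- s)) * ennreal ?M ^ card {1..N}) *
      emeasure (null_law N) (not_stopped N T \<nu>)"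
  proof (rule nn_integral_tilted_le[OF \<nu>, where k = "\<lambda>x. 1 - p + p * x"])
    show "not_stopped N T \<nu> \<in> sets (obs_filtration N (enat (\<nu> - 1)))"
      by (rule not_stopped_sets_obs_filtration[OF T \<nu>])
    show "?E \<in> sets (null_law N)" using E sets_obs_filtration_subset by blast
    show "(\<integral>\<^sup>+\<omega>. ennreal ((1 - p + p * window_lr \<mu> \<nu> m n \<omega>) powr (1 + s)) \<partial>null_law N) \<le> ennreal ?M"
      if "n \<in> {1..N}" for n
      using that \<nu> p s by (intro nn_integral_mixture_powr_le) auto
  qed (use p q c s in \<open>auto intro: add_pos_nonneg\<close>)
  also have "ennreal c * ennreal q + ennreal (c powr (- s)) * ennreal ?M ^ card {1..N} =
      ennreal (c * q + c powr (- s) * ?M ^ N)"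
    using c q0 M0 by (simp add: ennreal_power ennreal_mult[symmetric] ennreal_plus[symmetric] zero_le_power del: ennreal_plus)
  finally show ?thesis .
qed

text \<open>The sparse regime: the moment is taken for a fixed affected set, where few streams give
  a small second moment, and the average over sets comes last.\<close>

lemma change_law_stopped_le_truncated:
  assumes T: "stopping_rule N T" and \<nu>: "1 \<le> \<nu>" and p: "0 \<le> p" "p \<le> 1" and c: "0 < c" and K: "0 < K"
    and q0: "0 \<le> q"
    and q: "emeasure (null_law N) (not_stopped N T \<nu> - not_stopped N T (\<nu> + m)) \<le>
      ennreal q * emeasure (null_law N) (not_stopped N T \<nu>)"
  shows "emeasure (change_law N p \<mu> \<nu>) (not_stopped N T \<nu> - not_stopped N T (\<nu> + m)) \<le>
    ennreal (c * q + exp (K * (m * \<mu>\<^sup>2)) / c + N * p / K) * emeasure (null_law N) (not_stopped N T \<nu>)"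
proof -
  let ?E = "not_stopped N T \<nu> - not_stopped N T (\<nu> + m)"
  let ?F = "not_stopped N T \<nu>"
  let ?R = "c * q + exp (K * (m * \<mu>\<^sup>2)) / c"
  note E = stopped_in_window_sets[OF T \<nu>, of m]
  note F = not_stopped_sets_obs_filtration[OF T \<nu>]
  have EN: "?E \<in> sets (null_law N)" using E sets_obs_filtration_subset by blast
  have FN: "?F \<in> sets (null_law N)" using F sets_obs_filtration_subset by blast
  have R0: "0 \<le> ?R" using c q0 by simp
  \<comment> \<open>The summand \<open>card A / K\<close> makes one bound valid for every
    \<open>A\<close>: for \<open>card A > K\<close> it exceeds 1 and the bound is trivial. Its
    average is the Markov term.\<close>
  have le: "emeasure (cond_law N \<mu> \<nu> A) ?E \<le> ennreal (?R + card A / K) * emeasure (null_law N) ?F"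
    if A: "A \<subseteq> {1..N}" for A
  proof (cases "card A \<le> K")
    case True
    have "emeasure (cond_law N \<mu> \<nu> A) ?E =
        (\<integral>\<^sup>+\<omega>. ennreal (\<Prod>n\<in>A. window_lr \<mu> \<nu> m n \<omega>) * indicator ?E \<omega> \<partial>null_law N)"
      using A \<nu> E by (rule cond_law_density)
    also have "\<dots> \<le> (ennreal c * ennreal q + ennreal (c powr (- 1)) * ennreal (exp (m * \<mu>\<^sup>2)) ^ card A) *
        emeasure (null_law N) ?F"
    \<comment> \<open>Here \<open>s = 1\<close>: the second moment of a single stream is
      \<open>exp (m * \<mu>\<^sup>2)\<close>.\<close>
    proof (rule nn_integral_tilted_le[OF \<nu> F EN _ q A, where k = "\<lambda>x. x"])
      show "(\<integral>\<^sup>+\<omega>. ennreal (window_lr \<mu> \<nu> m n \<omega> powr (1 + 1)) \<partial>null_law N) \<le> ennreal (exp (m * \<mu>\<^sup>2))"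
        if "n \<in> A" for n
        using that A \<nu> by (subst nn_integral_window_lr_powr) auto
    qed (use c in auto)
    also have "ennreal c * ennreal q + ennreal (c powr (- 1)) * ennreal (exp (m * \<mu>\<^sup>2)) ^ card A =
        ennreal (c * q + exp (card A * (m * \<mu>\<^sup>2)) / c)"
      using c q0 by (simp add: ennreal_power ennreal_mult[symmetric] ennreal_plus[symmetric] exp_of_nat_mult
          powr_minus divide_inverse mult.commute del: ennreal_plus)
    also have "\<dots> * emeasure (null_law N) ?F \<le> ennreal (?R + card A / K) * emeasure (null_law N) ?F"
    proof (intro mult_right_mono ennreal_leI)
      have "exp (card A * (m * \<mu>\<^sup>2)) / c \<le> exp (K * (m * \<mu>\<^sup>2)) / c"
        using True c by (intro divide_right_mono) (auto intro!: mult_right_mono)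
      moreover have "0 \<le> card A / K" using K by simp
      ultimately show "c * q + exp (card A * (m * \<mu>\<^sup>2)) / c \<le> ?R + card A / K" by linarith
    qed simp
    finally show ?thesis .
  next
    case False
    have "emeasure (cond_law N \<mu> \<nu> A) ?E \<le> emeasure (cond_law N \<mu> \<nu> A) ?F"
      using FN by (intro emeasure_mono) auto
    also have "\<dots> = emeasure (null_law N) ?F"
      using F \<nu> by (intro cond_law_before_change[of "\<nu> - 1"]) auto
    also have "\<dots> \<le> ennreal (?R + card A / K) * emeasure (null_law N) ?F"
    proof -
      have "1 \<le> card A / K" using False K by simp
      then have "1 \<le> ennreal (?R + card A / K)" using R0 ennreal_leI[of 1 "?R + card A / K"] by simp
      then show ?thesis using mult_right_mono[of 1 "ennreal (?R + card A / K)" "emeasure (null_law N) ?F"] by simp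
    qed
    finally show ?thesis .
  qed
  have "emeasure (change_law N p \<mu> \<nu>) ?E = (\<integral>\<^sup>+A. emeasure (cond_law N \<mu> \<nu> A) ?E \<partial>measure_pmf (affected_pmf N p))"
    by (rule emeasure_change_law[OF EN])
  also have "\<dots> \<le> (\<integral>\<^sup>+A. ennreal (?R + card A / K) * emeasure (null_law N) ?F \<partial>measure_pmf (affected_pmf N p))"
    by (intro nn_integral_mono_AE AE_pmfI le affected_pmf_subset)
  also have "\<dots> = (\<integral>\<^sup>+A. ennreal (?R + card A / K) \<partial>measure_pmf (affected_pmf N p)) * emeasure (null_law N) ?F"
    by (rule nn_integral_multc) simp
  also have "(\<integral>\<^sup>+A. ennreal (?R + card A / K) \<partial>measure_pmf (affected_pmf N p)) =
      (\<integral>\<^sup>+A. ennreal ?R + ennreal (1 / K) * ennreal (card A) \<partial>measure_pmf (affected_pmf N p))"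
    using R0 K by (intro nn_integral_cong) (simp add: ennreal_mult[symmetric] ennreal_plus[symmetric] del: ennreal_plus)
  also have "\<dots> = ennreal ?R + ennreal (1 / K) * ennreal (real N * p)"
    by (subst nn_integral_add) (simp_all add: nn_integral_cmult nn_integral_affected_pmf_card[OF p])
  also have "\<dots> = ennreal (c * q + exp (K * (m * \<mu>\<^sup>2)) / c + N * p / K)"
    using R0 K p by (simp add: ennreal_mult[symmetric] ennreal_plus[symmetric] del: ennreal_plus)
  finally show ?thesis .
qed

subsection \<open>Average run length and detection delay\<close>

lemma measurable_stopping_rule:
  assumes T: "stopping_rule N T"
  shows "T \<in> measurable (null_law N) (count_space UNIV)"
proof -
  have le: "{\<omega> \<in> space (null_law N). T \<omega> \<le> t} \<in> sets (null_law N)" for t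
    using stopping_timeD[of "obs_filtration N" T t] T sets_obs_filtration_subset[of N t]
    by (auto simp: stopping_rule_def pred_def)
  have "T -` {t} \<inter> space (null_law N) \<in> sets (null_law N)" for t
  proof -
    have "T -` {t} \<inter> space (null_law N) =
        {\<omega> \<in> space (null_law N). T \<omega> \<le> t} - (\<Union>s\<in>{..<t}. {\<omega> \<in> space (null_law N). T \<omega> \<le> s})"
      by (auto simp: less_le not_less)
    also have "\<dots> \<in> sets (null_law N)"
      by (intro sets.Diff sets.countable_UN'' le) auto
    finally show ?thesis .
  qed
  then show ?thesis by (subst measurable_count_space_eq_countable) auto
qed

lemma ARL_eq_suminf:
  assumes T: "stopping_rule N T"
  shows "ARL N T = (\<Sum>k. emeasure (null_law N) (not_stopped N T (Suc k)))"
proof -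
  have "enat k < T \<omega> \<longleftrightarrow> enat (Suc k) \<le> T \<omega>" for k \<omega>
    by (cases "T \<omega>") auto
  then show ?thesis
    unfolding ARL_def nn_integral_enat_function[OF measurable_stopping_rule[OF T]] not_stopped_def by simp
qed

lemma sum_lessThan_shift_split: "(\<Sum>k<m + n. b k) = (\<Sum>k<m. b k) + (\<Sum>k<n. b (k + m))"
  for b :: "nat \<Rightarrow> real"
  by (induction n) (auto simp: add_ac)

text \<open>If the stopping probability exceeded the bound after every \<open>\<nu>\<close>, then
  \<open>b k = P\<^sub>\<infinity>(T > k)\<close> would satisfy \<open>b (k + m) \<le> (1 - q) b k\<close> with \<open>q = 2 m / \<gamma>\<close>, so its partial
  sums \<open>S\<close> would satisfy \<open>S \<le> m + (1 - q) S\<close>, that is \<open>S \<le> \<gamma> / 2\<close>.\<close>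

lemma exists_window_rarely_stopped:
  assumes T: "stopping_rule N T" and m: "1 \<le> m" and \<gamma>: "0 < \<gamma>" and ARL: "ennreal \<gamma> \<le> ARL N T"
  shows "\<exists>\<nu>\<ge>1. 0 < emeasure (null_law N) (not_stopped N T \<nu>) \<and>
    emeasure (null_law N) (not_stopped N T \<nu> - not_stopped N T (\<nu> + m)) \<le>
      ennreal (2 * real m / \<gamma>) * emeasure (null_law N) (not_stopped N T \<nu>)"
    (is ?goal)
proof (rule ccontr)
  assume contr: "\<not> ?goal"
  have neg: "\<not> emeasure (null_law N) (not_stopped N T \<nu> - not_stopped N T (\<nu> + m)) \<le>
      ennreal (2 * real m / \<gamma>) * emeasure (null_law N) (not_stopped N T \<nu>)"
    if "1 \<le> \<nu>" "0 < emeasure (null_law N) (not_stopped N T \<nu>)" for \<nu>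
  proof
    assume "emeasure (null_law N) (not_stopped N T \<nu> - not_stopped N T (\<nu> + m)) \<le>
      ennreal (2 * real m / \<gamma>) * emeasure (null_law N) (not_stopped N T \<nu>)"
    with that have ?goal by (intro exI[of _ \<nu>] conjI)
    with contr show False by (rule notE)
  qed
  interpret P: prob_space "null_law N" by (rule prob_space_null_law)
  define q where "q = 2 * real m / \<gamma>"
  define b where "b k = measure (null_law N) (not_stopped N T (Suc k))" for k
  have q: "0 < q" using m \<gamma> by (simp add: q_def)
  have step: "b (k + m) \<le> (1 - q) * b k" for k
  proof -
    have diff: "measure (null_law N) (not_stopped N T (Suc k) - not_stopped N T (Suc k + m)) = b k - b (k + m)"
      unfolding b_def using not_stopped_antimono[of "Suc k" "Suc k + m" N T] not_stopped_sets_null_law[OF T]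
      by (subst P.finite_measure_Diff) auto
    show ?thesis
    \<comment> \<open>Where \<open>b k\<close> vanishes the contradiction hypothesis says nothing,
      but monotonicity gives the step.\<close>
    proof (cases "b k = 0")
      case True
      have "b (k + m) \<le> b k"
        unfolding b_def using not_stopped_antimono not_stopped_sets_null_law[OF T]
        by (intro P.finite_measure_mono) auto
      then show ?thesis using True by simp
    next
      case False
      then have "0 < emeasure (null_law N) (not_stopped N T (Suc k))"
        by (auto simp: b_def P.emeasure_eq_measure zero_less_measure_iff)
      with neg[of "Suc k"] have "\<not> emeasure (null_law N) (not_stopped N T (Suc k) - not_stopped N T (Suc k + m)) \<le>
          ennreal q * emeasure (null_law N) (not_stopped N T (Suc k))"
        by (simp add: q_def)
      then have "\<not> b k - b (k + m) \<le> q * b k"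
        using q diff[unfolded b_def]
        by (simp add: P.emeasure_eq_measure b_def ennreal_mult[symmetric] ennreal_le_iff)
      then show ?thesis by (simp add: algebra_simps)
    qed
  qed
  have b: "0 \<le> b k" "b k \<le> 1" for k by (auto simp: b_def)
  \<comment> \<open>Finite partial sums may be subtracted although the series is not yet known to
    converge; extending the sum by \<open>m\<close> terms makes room for the shift.\<close>
  have S: "(\<Sum>k<n. b k) \<le> \<gamma> / 2" for n
  proof -
    have "(\<Sum>k<n. b k) \<le> (\<Sum>k<m + n. b k)"
      using b by (intro sum_mono2) auto
    also have "\<dots> = (\<Sum>k<m. b k) + (\<Sum>k<n. b (k + m))"
      by (rule sum_lessThan_shift_split)
    also have "\<dots> \<le> (\<Sum>k<m. 1) + (\<Sum>k<n. (1 - q) * b k)"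
      using b step by (intro add_mono sum_mono) auto
    also have "\<dots> = m + (1 - q) * (\<Sum>k<n. b k)"
      by (simp add: sum_distrib_left)
    finally have "q * (\<Sum>k<n. b k) \<le> m" by (simp add: algebra_simps)
    then show ?thesis using m \<gamma> by (simp add: q_def field_simps)
  qed
  have "ARL N T = (\<Sum>k. ennreal (b k))"
    by (simp add: ARL_eq_suminf[OF T] b_def P.emeasure_eq_measure)
  also have "\<dots> \<le> ennreal (\<gamma> / 2)"
    using S b \<gamma> by (intro suminf_le_const) (auto simp: sum_ennreal intro!: ennreal_leI)
  also have "\<dots> < ennreal \<gamma>" using \<gamma> by (simp add: ennreal_less_iff)
  finally show False using ARL by simp
qed

text \<open>Given \<open>T \<ge> \<nu>\<close>, the rule survives the window with probability at
  least \<open>1 - R\<close>, and then the delay is at least \<open>m\<close>. For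
  \<open>R > 1\<close> the claim is trivial, as \<open>ennreal\<close> sends negative numbers to
  0.\<close>

lemma detection_delay_ge:
  assumes T: "stopping_rule N T" and \<nu>: "1 \<le> \<nu>"
    and pos: "0 < emeasure (null_law N) (not_stopped N T \<nu>)"
    and R: "0 \<le> R"
    and stop: "emeasure (change_law N p \<mu> \<nu>) (not_stopped N T \<nu> - not_stopped N T (\<nu> + m)) \<le>
      ennreal R * emeasure (null_law N) (not_stopped N T \<nu>)"
  shows "ennreal (m * (1 - R)) \<le> detection_delay N p \<mu> T"
proof -
  interpret P: prob_space "change_law N p \<mu> \<nu>" by (rule prob_space_change_law)
  let ?P = "change_law N p \<mu> \<nu>" and ?F = "not_stopped N T \<nu>" and ?G = "not_stopped N T (\<nu> + m)"
  have [measurable]: "?F \<in> sets ?P" "?G \<in> sets ?P"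
    using not_stopped_sets_null_law[OF T] \<nu> by auto
  have sub: "?G \<subseteq> ?F" by (rule not_stopped_antimono) simp
  \<comment> \<open>The hypotheses compare with the null probability of
    \<open>T \<ge> \<nu>\<close>, the delay conditions under the change law; the two probabilities
    agree.\<close>
  have F: "emeasure (null_law N) ?F = emeasure ?P ?F"
    using change_law_before_change[OF _ not_stopped_sets_obs_filtration[OF T \<nu>]] \<nu> by simp
  then have posP: "0 < measure ?P ?F" using pos by (simp add: P.emeasure_eq_measure)
  have "measure ?P ?F - measure ?P ?G \<le> R * measure ?P ?F"
    using stop P.finite_measure_Diff[OF \<open>?F \<in> sets ?P\<close> \<open>?G \<in> sets ?P\<close> sub] R
    by (simp add: F P.emeasure_eq_measure ennreal_mult[symmetric] ennreal_le_iff)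
  then have G: "1 - R \<le> measure ?P ?G / measure ?P ?F"
    using posP by (simp add: field_simps)
  have "ennreal (m * (1 - R)) \<le> ennreal (m * (measure ?P ?G / measure ?P ?F))"
    using G by (intro ennreal_leI mult_left_mono) auto
  also have "\<dots> = ennreal m * (emeasure ?P (?F \<inter> ?G) / emeasure ?P ?F)"
    using posP sub by (simp add: P.emeasure_eq_measure ennreal_mult[symmetric] divide_ennreal Int_absorb1)
  also have "\<dots> = ennreal m * emeasure (uniform_measure ?P ?F) ?G"
    by (subst emeasure_uniform_measure[OF \<open>?F \<in> sets ?P\<close> \<open>?G \<in> sets ?P\<close>]) (rule refl)
  also have "\<dots> = (\<integral>\<^sup>+\<omega>. ennreal m * indicator ?G \<omega> \<partial>uniform_measure ?P ?F)"
    using \<open>?G \<in> sets ?P\<close> by (subst nn_integral_cmult_indicator) auto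
  also have "\<dots> \<le> cond_delay N p \<mu> T \<nu>"
    unfolding cond_delay_def
  proof (rule nn_integral_mono)
    fix \<omega>
    show "ennreal m * indicator ?G \<omega> \<le> ennreal_of_enat (T \<omega> - enat \<nu> + 1)"
    proof (cases "\<omega> \<in> ?G")
      case True
      then have le: "enat (\<nu> + m) \<le> T \<omega>" by (simp add: not_stopped_def)
      have "enat m \<le> T \<omega> - enat \<nu> + 1"
        using le by (cases "T \<omega>") (auto simp: one_enat_def)
      then have "ennreal_of_enat (enat m) \<le> ennreal_of_enat (T \<omega> - enat \<nu> + 1)"
        by (rule iffD2[OF ennreal_of_enat_le_iff])
      then show ?thesis using True by (simp add: ennreal_of_nat_eq_real_of_nat)
    qed simp
  qed
  also have "\<dots> \<le> detection_delay N p \<mu> T"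
    unfolding detection_delay_def by (rule SUP_upper) (use \<nu> pos F in simp)
  finally show ?thesis .
qed

subsection \<open>Asymptotics\<close>

text \<open>The threshold \<open>sqrt \<gamma>\<close> splits the factor \<gamma>: one root damps
  the window probability \<open>2 m / \<gamma>\<close>, the other, to the power \<open>s\<close>, is
  set against the moment.\<close>

lemma detection_delay_ge_mixture:
  fixes m :: nat
  assumes T: "stopping_rule N T" and p: "0 \<le> p" "p < 1" and s: "0 \<le> s" "s \<le> 1" and m: "1 \<le> m"
    and \<gamma>: "0 < \<gamma>" and ARL: "ennreal \<gamma> \<le> ARL N T"
  shows "ennreal (real m * (1 - (2 * real m / sqrt \<gamma> + sqrt \<gamma> powr (- s) *
    (1 + p powr (1 + s) * exp (s * (1 + s) * (real m * \<mu>\<^sup>2 / 2))) ^ N))) \<le> detection_delay N p \<mu> T"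
proof -
  obtain \<nu> where \<nu>: "1 \<le> \<nu>" "0 < emeasure (null_law N) (not_stopped N T \<nu>)"
    "emeasure (null_law N) (not_stopped N T \<nu> - not_stopped N T (\<nu> + m)) \<le>
      ennreal (2 * real m / \<gamma>) * emeasure (null_law N) (not_stopped N T \<nu>)"
    using exists_window_rarely_stopped[OF T m \<gamma> ARL] by auto
  have c: "0 < sqrt \<gamma>" and q: "0 \<le> 2 * real m / \<gamma>" using \<gamma> by auto
  have "sqrt \<gamma> * (2 * real m / \<gamma>) = 2 * real m / sqrt \<gamma>"
    using \<gamma> by (simp add: real_div_sqrt field_simps)
  then show ?thesis
    using change_law_stopped_le_mixture[OF T \<nu>(1) p s c q \<nu>(3), of \<mu>] c
    by (intro detection_delay_ge[OF T \<nu>(1,2)]) (auto intro!: add_nonneg_nonneg zero_le_power)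
qed

lemma detection_delay_ge_truncated:
  fixes m :: nat
  assumes T: "stopping_rule N T" and p: "0 \<le> p" "p \<le> 1" and K: "0 < K" and m: "1 \<le> m"
    and \<gamma>: "0 < \<gamma>" and ARL: "ennreal \<gamma> \<le> ARL N T"
  shows "ennreal (real m * (1 - (2 * real m / sqrt \<gamma> + exp (K * (real m * \<mu>\<^sup>2)) / sqrt \<gamma> + real N * p / K))) \<le>
    detection_delay N p \<mu> T"
proof -
  obtain \<nu> where \<nu>: "1 \<le> \<nu>" "0 < emeasure (null_law N) (not_stopped N T \<nu>)"
    "emeasure (null_law N) (not_stopped N T \<nu> - not_stopped N T (\<nu> + m)) \<le>
      ennreal (2 * real m / \<gamma>) * emeasure (null_law N) (not_stopped N T \<nu>)"
    using exists_window_rarely_stopped[OF T m \<gamma> ARL] by auto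
  have c: "0 < sqrt \<gamma>" and q: "0 \<le> 2 * real m / \<gamma>" using \<gamma> by auto
  have "sqrt \<gamma> * (2 * real m / \<gamma>) = 2 * real m / sqrt \<gamma>"
    using \<gamma> by (simp add: real_div_sqrt field_simps)
  then show ?thesis
    using change_law_stopped_le_truncated[OF T \<nu>(1) p c K q \<nu>(3), of \<mu>] c p K
    by (intro detection_delay_ge[OF T \<nu>(1,2)]) auto
qed

text \<open>Bounds up to a factor 2 are enough below, since constants do not affect the comparison
  of powers of \<open>N\<close>.\<close>

lemma asymp_equiv_eventually_bounds:
  fixes f g :: "nat \<Rightarrow> real"
  assumes "f \<sim>[sequentially] g" and pos: "eventually (\<lambda>n. 0 < g n) sequentially"
  shows "eventually (\<lambda>n. g n / 2 \<le> f n) sequentially" "eventually (\<lambda>n. f n \<le> 2 * g n) sequentially"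
proof -
  have "((\<lambda>n. f n / g n) \<longlongrightarrow> 1) sequentially"
    using assms by (intro asymp_equivD_strong) (auto elim: eventually_mono)
  then have l: "eventually (\<lambda>n. 1 / 2 < f n / g n) sequentially" and u: "eventually (\<lambda>n. f n / g n < 2) sequentially"
    by (rule order_tendstoD; simp)+
  show "eventually (\<lambda>n. g n / 2 \<le> f n) sequentially"
    using l pos by eventually_elim (simp add: field_simps)
  show "eventually (\<lambda>n. f n \<le> 2 * g n) sequentially"
    using u pos by eventually_elim (simp add: field_simps)
qed

lemma le_liminf_delay_div_ln:
  assumes "eventually (\<lambda>N. ennreal (f N) \<le> D N) sequentially"
    and "(\<lambda>N. f N / ln (real N)) \<longlonglongrightarrow> l"
  shows "ereal l \<le> liminf (\<lambda>N. enn2ereal (D N) / ereal (ln (real N)))"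
proof -
  have "ereal l = liminf (\<lambda>N. ereal (f N / ln (real N)))"
    using assms(2) by (intro lim_imp_Liminf[symmetric]) auto
  also have "\<dots> \<le> liminf (\<lambda>N. enn2ereal (D N) / ereal (ln (real N)))"
  proof (rule Liminf_mono)
    show "eventually (\<lambda>N. ereal (f N / ln (real N)) \<le> enn2ereal (D N) / ereal (ln (real N))) sequentially"
      using assms(1) eventually_ge_at_top[of 2]
    proof eventually_elim
      case (elim N)
      have "ereal (f N) \<le> enn2ereal (D N)"
      proof (cases "0 \<le> f N")
        case True
        then show ?thesis using elim(1) by (metis enn2ereal_ennreal less_eq_ennreal.rep_eq)
      next
        \<comment> \<open>A negative \<open>f N\<close> becomes 0 in \<open>ennreal\<close>, so the
          hypothesis is empty; the delay is nonnegative anyway.\<close>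
        case False
        then have "ereal (f N) \<le> 0" by simp
        then show ?thesis using enn2ereal_nonneg order_trans by blast
      qed
      then have "ereal (f N) / ereal (ln (real N)) \<le> enn2ereal (D N) / ereal (ln (real N))"
        using elim(2) by (intro ereal_divide_right_mono) auto
      then show ?case using elim(2) by simp
    qed
  qed
  finally show ?thesis .
qed

lemma le_liminf_ln_delay_div_ln:
  assumes "eventually (\<lambda>N. 0 < f N \<and> ennreal (f N) \<le> D N) sequentially"
    and "(\<lambda>N. ln (f N) / ln (real N)) \<longlonglongrightarrow> l"
  shows "ereal l \<le> liminf (\<lambda>N. ext_ln (D N) / ereal (ln (real N)))"
proof -
  have "ereal l = liminf (\<lambda>N. ereal (ln (f N) / ln (real N)))"
    using assms(2) by (intro lim_imp_Liminf[symmetric]) auto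
  also have "\<dots> \<le> liminf (\<lambda>N. ext_ln (D N) / ereal (ln (real N)))"
  proof (rule Liminf_mono)
    show "eventually (\<lambda>N. ereal (ln (f N) / ln (real N)) \<le> ext_ln (D N) / ereal (ln (real N))) sequentially"
      using assms(1) eventually_ge_at_top[of 2]
    proof eventually_elim
      case (elim N)
      have "ereal (ln (f N)) \<le> ext_ln (D N)"
      proof (cases "D N")
        case (real d)
        \<comment> \<open>With \<open>f N > 0\<close> this excludes \<open>d = 0\<close>, where
          \<open>ext_ln\<close> is minus infinity.\<close>
        then have "f N \<le> d" using elim(1) by (simp add: ennreal_le_iff)
        then show ?thesis using elim(1) real by (simp add: ext_ln_def)
      next
        case top
        then show ?thesis by (simp add: ext_ln_def)
      qed
      then have "ereal (ln (f N)) / ereal (ln (real N)) \<le> ext_ln (D N) / ereal (ln (real N))"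
        using elim(2) by (intro ereal_divide_right_mono) auto
      then show ?case using elim(2) by simp
    qed
  qed
  finally show ?thesis .
qed

section \<open>The constant \<open>rho\<close> and the optimal moment order\<close>

lemma rho_pos:
  assumes "(1 - \<zeta>) / 2 < \<beta>" "\<beta> < 1 - \<zeta>" "0 < \<beta>"
  shows "0 < rho \<beta> \<zeta>"
proof -
  have "sqrt (1 - \<zeta> - \<beta>) < sqrt (1 - \<zeta>)" using assms by simp
  then show ?thesis using assms by (simp add: rho_def)
qed

text \<open>The optimal exponent: \<open>s\<close> maximises \<open>(1 + s) (\<beta> - s r)\<close> over \<open>s \<le> 1\<close> at \<open>r = \<rho>\<close>, with maximum
  \<open>1 - \<zeta>\<close>. The two cases of \<open>\<rho>\<close> are a maximum at the boundary \<open>s = 1\<close> and an interior one.\<close>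

lemma exists_moment_exponent:
  assumes \<zeta>: "\<zeta> < 1" and \<beta>: "(1 - \<zeta>) / 2 < \<beta>" "\<beta> < 1 - \<zeta>" and r: "r < rho \<beta> \<zeta>"
  shows "\<exists>s. 0 < s \<and> s \<le> 1 \<and> 1 - \<zeta> < (1 + s) * (\<beta> - s * r)"
proof (cases "\<beta> \<le> 3 * (1 - \<zeta>) / 4")
  case True
  then have "r < \<beta> - (1 - \<zeta>) / 2" using r by (simp add: rho_def)
  then show ?thesis by (intro exI[of _ 1]) (simp add: field_simps)
next
  case False
  define a where "a = sqrt (1 - \<zeta>)"
  define b where "b = sqrt (1 - \<zeta> - \<beta>)"
  have r': "r < (a - b)\<^sup>2" using False r by (simp add: rho_def a_def b_def)
  have a2: "a\<^sup>2 = 1 - \<zeta>" and b2: "b\<^sup>2 = 1 - \<zeta> - \<beta>" using \<zeta> \<beta> by (simp_all add: a_def b_def)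
  have b: "0 < b" using \<beta> by (simp add: b_def)
  have a: "0 < a" using \<zeta> by (simp add: a_def)
  \<comment> \<open>The case assumption says exactly \<open>2 * b < a\<close>, that is, the
    stationary point below is less than 1.\<close>
  have "(2 * b)\<^sup>2 < a\<^sup>2" using False by (simp add: a2 b2 power_mult_distrib)
  then have ab: "2 * b < a" using a by (rule power2_less_imp_less[OF _ less_imp_le])
  \<comment> \<open>The stationary point of the quadratic \<open>(1 + s) * (\<beta> - s * r)\<close>
    in \<open>s\<close> at \<open>r = (a - b)\<^sup>2\<close>, using
    \<open>\<beta> = a\<^sup>2 - b\<^sup>2\<close>.\<close>
  define s where "s = b / (a - b)"
  have s: "0 < s" "s \<le> 1" using ab b by (auto simp: s_def)
  have sab: "s * (a - b) = b" "(1 + s) * (a - b) = a" using ab b by (auto simp: s_def field_simps)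
  have "\<beta> = (a + b) * (a - b)" using a2 b2 by (simp add: power2_eq_square algebra_simps)
  then have "\<beta> - s * (a - b)\<^sup>2 = (a + b - s * (a - b)) * (a - b)"
    by (simp add: power2_eq_square algebra_simps)
  also have "\<dots> = a * (a - b)" unfolding sab by simp
  finally have "(1 + s) * (\<beta> - s * (a - b)\<^sup>2) = ((1 + s) * (a - b)) * a" by simp
  also have "\<dots> = 1 - \<zeta>" unfolding sab using a2 by (simp add: power2_eq_square)
  finally have "1 - \<zeta> = (1 + s) * (\<beta> - s * (a - b)\<^sup>2)" ..
  also have "\<dots> < (1 + s) * (\<beta> - s * r)"
    using s r' by (intro mult_strict_left_mono diff_strict_left_mono) auto
  finally show ?thesis using s by auto
qed

section \<open>The dense and the sparse regime\<close>

lemma sqrt_powr_uminus_le: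
  fixes g x s :: real
  assumes "0 < g" and "x \<le> ln g" and "0 \<le> s"
  shows "sqrt g powr (- s) \<le> exp (- (s * x / 2))"
proof -
  have "sqrt g powr (- s) = exp (- (s * ln g / 2))"
    using assms(1) by (simp add: powr_def ln_sqrt)
  also have "\<dots> \<le> exp (- (s * x / 2))"
    using mult_left_mono[OF assms(2,3)] by simp
  finally show ?thesis .
qed

lemma detection_delay_dense:
  fixes \<mu> \<zeta> \<beta> r s :: real and \<gamma> p :: "nat \<Rightarrow> real" and T :: "nat \<Rightarrow> path \<Rightarrow> enat"
  assumes \<mu>: "0 < \<mu>" and \<zeta>: "0 < \<zeta>"
    and \<gamma>1: "\<And>N. 1 \<le> N \<Longrightarrow> 1 \<le> \<gamma> N" and \<gamma>: "(\<lambda>N. ln (\<gamma> N)) \<sim>[sequentially] (\<lambda>N. real N powr \<zeta>)"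
    and T: "\<And>N. 1 \<le> N \<Longrightarrow> stopping_rule N (T N)"
    and ARL: "\<And>N. 1 \<le> N \<Longrightarrow> ennreal (\<gamma> N) \<le> ARL N (T N)"
    and p01: "\<And>N. 1 \<le> N \<Longrightarrow> 0 < p N \<and> p N < 1"
    and p: "p \<sim>[sequentially] (\<lambda>N. real N powr (- \<beta>))"
    and r: "0 < r" and s: "0 < s" "s \<le> 1" and ex: "1 - \<zeta> < (1 + s) * (\<beta> - s * r)"
  shows "ereal (2 / \<mu>\<^sup>2 * r) \<le>
    liminf (\<lambda>N. enn2ereal (detection_delay N (p N) \<mu> (T N)) / ereal (ln (real N)))"
proof -
  \<comment> \<open>Chosen so that a window of length at most \<open>c * ln N\<close> has
    \<open>m * \<mu>\<^sup>2 / 2 \<le> r * ln N\<close>, turning the exponential moment into a power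
    of \<open>N\<close>.\<close>
  define c where "c = 2 / \<mu>\<^sup>2 * r"
  define m where "m N = nat \<lfloor>c * ln (real N)\<rfloor>" for N
  \<comment> \<open>The margin in the exponent: \<open>N * u N\<close> is at most a constant times
    \<open>N powr (\<zeta> - d)\<close>, which loses against the order \<zeta> of
    \<open>ln \<gamma>\<close>.\<close>
  define d where "d = (1 + s) * (\<beta> - s * r) - (1 - \<zeta>)"
  define u where "u N = p N powr (1 + s) * exp (s * (1 + s) * (real (m N) * \<mu>\<^sup>2 / 2))" for N
  define R where "R N = 2 * real (m N) / sqrt (\<gamma> N) + sqrt (\<gamma> N) powr (- s) * (1 + u N) ^ N" for N
  \<comment> \<open>An explicit majorant of \<open>R\<close>. The divisor 4 combines the square root
    of \<gamma> with the lower bound \<open>N powr \<zeta> / 2\<close> for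
    \<open>ln \<gamma>\<close>.\<close>
  define R' where "R' N = 2 * c * ln (real N) * exp (- (real N powr \<zeta>) / 4) +
    exp (2 powr (1 + s) * real N powr (\<zeta> - d) - (s / 4) * (real N powr \<zeta>))" for N
  have c: "0 < c" using \<mu> r by (simp add: c_def)
  have d: "0 < d" using ex by (simp add: d_def)
  have powr_pos: "eventually (\<lambda>N. 0 < real N powr e) sequentially" for e
    using eventually_gt_at_top[of 0] by eventually_elim simp
  have \<gamma>_ge: "eventually (\<lambda>N. real N powr \<zeta> / 2 \<le> ln (\<gamma> N)) sequentially"
    by (rule asymp_equiv_eventually_bounds(1)[OF \<gamma> powr_pos])
  have p_le: "eventually (\<lambda>N. p N \<le> 2 * real N powr (- \<beta>)) sequentially"
    by (rule asymp_equiv_eventually_bounds(2)[OF p powr_pos])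
  have R_le: "eventually (\<lambda>N. R N \<le> R' N) sequentially"
    using \<gamma>_ge p_le eventually_ge_at_top[of 1]
  proof eventually_elim
    case (elim N)
    have N: "0 < real N" "0 \<le> ln (real N)" using elim(3) by auto
    have g: "0 < \<gamma> N" using \<gamma>1[OF elim(3)] by simp
    have mle: "real (m N) \<le> c * ln (real N)"
      unfolding m_def using c N by (intro of_nat_floor) auto
    have "sqrt (\<gamma> N) powr (- 1) \<le> exp (- (real N powr \<zeta>) / 4)"
      using sqrt_powr_uminus_le[OF g elim(1), of 1] by simp
    then have "1 / sqrt (\<gamma> N) \<le> exp (- (real N powr \<zeta>) / 4)"
      using g by (simp add: powr_minus_divide)
    then have "(2 * real (m N)) * (1 / sqrt (\<gamma> N)) \<le> (2 * (c * ln (real N))) * exp (- (real N powr \<zeta>) / 4)"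
      using mle g N c by (intro mult_mono) auto
    then have 1: "2 * real (m N) / sqrt (\<gamma> N) \<le> 2 * c * ln (real N) * exp (- (real N powr \<zeta>) / 4)"
      by simp
    have 2: "sqrt (\<gamma> N) powr (- s) \<le> exp (- (s / 4 * real N powr \<zeta>))"
      using sqrt_powr_uminus_le[OF g elim(1), of s] s by simp
    have u0: "0 \<le> u N" by (simp add: u_def)
    have "u N \<le> (2 * real N powr (- \<beta>)) powr (1 + s) * exp (s * (1 + s) * (r * ln (real N)))"
      unfolding u_def
    proof (intro mult_mono powr_mono2 iffD2[OF exp_le_cancel_iff] mult_left_mono)
      have "real (m N) * \<mu>\<^sup>2 / 2 \<le> (c * ln (real N)) * \<mu>\<^sup>2 / 2"
        using mle by (intro divide_right_mono mult_right_mono) auto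
      then show "real (m N) * \<mu>\<^sup>2 / 2 \<le> r * ln (real N)" using \<mu> by (simp add: c_def)
    qed (use s elim p01[OF elim(3)] in auto)
    also have "\<dots> = 2 powr (1 + s) * real N powr (- (\<beta> * (1 + s)) + s * (1 + s) * r)"
    proof -
      have "exp (s * (1 + s) * (r * ln (real N))) = real N powr (s * (1 + s) * r)"
        using N by (simp add: powr_def mult_ac)
      moreover have "(2 * real N powr (- \<beta>)) powr (1 + s) = 2 powr (1 + s) * real N powr (- (\<beta> * (1 + s)))"
        by (subst powr_mult) (simp add: powr_powr)
      ultimately show ?thesis by (simp only: powr_add mult.assoc)
    qed
    finally have "real N * u N \<le> real N powr 1 * (2 powr (1 + s) * real N powr (- (\<beta> * (1 + s)) + s * (1 + s) * r))"
      using N by (simp add: mult_left_mono)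
    also have "\<dots> = 2 powr (1 + s) * real N powr (1 + (- (\<beta> * (1 + s)) + s * (1 + s) * r))"
      by (simp only: powr_add mult_ac)
    also have "1 + (- (\<beta> * (1 + s)) + s * (1 + s) * r) = \<zeta> - d"
      by (simp add: d_def algebra_simps)
    finally have Nu: "real N * u N \<le> 2 powr (1 + s) * real N powr (\<zeta> - d)" .
    have "(1 + u N) ^ N \<le> exp (u N) ^ N"
      using u0 by (intro power_mono exp_ge_add_one_self) auto
    also have "\<dots> \<le> exp (2 powr (1 + s) * real N powr (\<zeta> - d))"
      using Nu by (simp add: exp_of_nat_mult[symmetric])
    finally have "sqrt (\<gamma> N) powr (- s) * (1 + u N) ^ N \<le>
        exp (- (s / 4 * real N powr \<zeta>)) * exp (2 powr (1 + s) * real N powr (\<zeta> - d))"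
      using 2 u0 by (intro mult_mono) auto
    also have "\<dots> = exp (2 powr (1 + s) * real N powr (\<zeta> - d) - (s / 4) * (real N powr \<zeta>))"
      by (simp add: exp_add[symmetric])
    finally show ?case using 1 by (simp add: R_def R'_def)
  qed
  have R_nonneg: "eventually (\<lambda>N. 0 \<le> R N) sequentially"
    using eventually_ge_at_top[of 1]
  proof eventually_elim
    case (elim N)
    then show ?case using \<gamma>1[OF elim] by (auto simp: R_def u_def intro!: add_nonneg_nonneg mult_nonneg_nonneg zero_le_power)
  qed
  have "(\<lambda>N. 2 * c * ln (real N) * exp (- (real N powr \<zeta>) / 4)) \<longlonglongrightarrow> 0"
    using \<zeta> c by real_asymp
  moreover have "(\<lambda>N. exp (2 powr (1 + s) * real N powr (\<zeta> - d) - (s / 4) * (real N powr \<zeta>))) \<longlonglongrightarrow> 0"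
    using \<zeta> d s by real_asymp
  ultimately have R'_lim: "R' \<longlonglongrightarrow> 0"
    unfolding R'_def by (rule tendsto_add_zero)
  have R: "R \<longlonglongrightarrow> 0"
    by (rule tendsto_sandwich[OF R_nonneg R_le tendsto_const R'_lim])
  have m: "(\<lambda>N. real (m N) / ln (real N)) \<longlonglongrightarrow> c"
    unfolding m_def using c by real_asymp
  have "(\<lambda>N. real (m N) / ln (real N) * (1 - R N)) \<longlonglongrightarrow> c * (1 - 0)"
    by (intro tendsto_intros m R)
  then have "(\<lambda>N. real (m N) * (1 - R N) / ln (real N)) \<longlonglongrightarrow> c" by simp
  moreover have "eventually (\<lambda>N. ennreal (real (m N) * (1 - R N)) \<le> detection_delay N (p N) \<mu> (T N)) sequentially"
  proof -
    have "eventually (\<lambda>N. 1 \<le> real (m N)) sequentially"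
      unfolding m_def using c by real_asymp
    with eventually_ge_at_top[of 1] show ?thesis
    proof eventually_elim
      case (elim N)
      have "0 < \<gamma> N" using \<gamma>1[OF elim(1)] by simp
      then show ?case
        unfolding R_def u_def using p01[OF elim(1)] s elim(2)
        by (intro detection_delay_ge_mixture T ARL elim(1)) auto
    qed
  qed
  ultimately show ?thesis unfolding c_def by (intro le_liminf_delay_div_ln)
qed

text \<open>The slack \<delta> is spent twice: once to put \<open>K\<close> above the mean number of
  affected streams, once to keep the second moment below \<open>sqrt \<gamma>\<close>.\<close>

lemma detection_delay_sparse:
  fixes \<mu> \<zeta> \<beta> \<delta> :: real and \<gamma> p :: "nat \<Rightarrow> real" and T :: "nat \<Rightarrow> path \<Rightarrow> enat"
  assumes \<zeta>: "0 < \<zeta>"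
    and \<gamma>1: "\<And>N. 1 \<le> N \<Longrightarrow> 1 \<le> \<gamma> N" and \<gamma>: "(\<lambda>N. ln (\<gamma> N)) \<sim>[sequentially] (\<lambda>N. real N powr \<zeta>)"
    and T: "\<And>N. 1 \<le> N \<Longrightarrow> stopping_rule N (T N)"
    and ARL: "\<And>N. 1 \<le> N \<Longrightarrow> ennreal (\<gamma> N) \<le> ARL N (T N)"
    and p01: "\<And>N. 1 \<le> N \<Longrightarrow> 0 < p N \<and> p N < 1"
    and p: "p \<sim>[sequentially] (\<lambda>N. real N powr (- \<beta>))"
    and \<delta>: "0 < \<delta>" and \<kappa>: "0 < \<beta> + \<zeta> - 1 - 2 * \<delta>"
  shows "ereal (\<beta> + \<zeta> - 1 - 2 * \<delta>) \<le>
    liminf (\<lambda>N. ext_ln (detection_delay N (p N) \<mu> (T N)) / ereal (ln (real N)))"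
proof -
  define \<kappa> where "\<kappa> = \<beta> + \<zeta> - 1 - 2 * \<delta>"
  define m where "m N = nat \<lfloor>real N powr \<kappa>\<rfloor>" for N
  \<comment> \<open>The mean number \<open>N * p\<close> is of order
    \<open>N powr (1 - \<beta>)\<close>, so the Markov term is of order
    \<open>N powr (- \<delta>)\<close>, while \<open>K * m\<close> stays at most
    \<open>N powr (\<zeta> - \<delta>)\<close>.\<close>
  define K where "K N = real N powr (1 - \<beta> + \<delta>)" for N
  define R where "R N = 2 * real (m N) / sqrt (\<gamma> N) + exp (K N * (real (m N) * \<mu>\<^sup>2)) / sqrt (\<gamma> N) +
    real N * p N / K N" for N
  define R' where "R' N = 2 * real N powr \<kappa> * exp (- (real N powr \<zeta>) / 4) +
    exp (\<mu>\<^sup>2 * real N powr (\<zeta> - \<delta>) - 1 / 4 * (real N powr \<zeta>)) + 2 * real N powr (- \<delta>)" for N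
  have \<kappa>: "0 < \<kappa>" using \<kappa> by (simp add: \<kappa>_def)
  have powr_pos: "eventually (\<lambda>N. 0 < real N powr e) sequentially" for e
    using eventually_gt_at_top[of 0] by eventually_elim simp
  have \<gamma>_ge: "eventually (\<lambda>N. real N powr \<zeta> / 2 \<le> ln (\<gamma> N)) sequentially"
    by (rule asymp_equiv_eventually_bounds(1)[OF \<gamma> powr_pos])
  have p_le: "eventually (\<lambda>N. p N \<le> 2 * real N powr (- \<beta>)) sequentially"
    by (rule asymp_equiv_eventually_bounds(2)[OF p powr_pos])
  have R_le: "eventually (\<lambda>N. R N \<le> R' N) sequentially"
    using \<gamma>_ge p_le eventually_ge_at_top[of 1]
  proof eventually_elim
    case (elim N)
    have N: "0 < real N" using elim(3) by simp
    have g: "0 < \<gamma> N" using \<gamma>1[OF elim(3)] by simp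
    have mle: "real (m N) \<le> real N powr \<kappa>"
      unfolding m_def by (intro of_nat_floor) auto
    have "sqrt (\<gamma> N) powr (- 1) \<le> exp (- (real N powr \<zeta>) / 4)"
      using sqrt_powr_uminus_le[OF g elim(1), of 1] by simp
    then have sg: "1 / sqrt (\<gamma> N) \<le> exp (- (real N powr \<zeta>) / 4)"
      using g by (simp add: powr_minus_divide)
    have "(2 * real (m N)) * (1 / sqrt (\<gamma> N)) \<le> (2 * real N powr \<kappa>) * exp (- (real N powr \<zeta>) / 4)"
      using mle g sg by (intro mult_mono) auto
    then have 1: "2 * real (m N) / sqrt (\<gamma> N) \<le> 2 * real N powr \<kappa> * exp (- (real N powr \<zeta>) / 4)"
      by simp
    have "K N * real (m N) \<le> real N powr (1 - \<beta> + \<delta>) * real N powr \<kappa>"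
      unfolding K_def using mle by (intro mult_left_mono) auto
    also have "\<dots> = real N powr (\<zeta> - \<delta>)"
      by (simp add: powr_add[symmetric] \<kappa>_def algebra_simps)
    finally have "K N * (real (m N) * \<mu>\<^sup>2) \<le> \<mu>\<^sup>2 * real N powr (\<zeta> - \<delta>)"
      using mult_right_mono[of "K N * real (m N)" "real N powr (\<zeta> - \<delta>)" "\<mu>\<^sup>2"]
      by (simp add: mult.assoc mult.commute[of "\<mu>\<^sup>2"])
    then have "exp (K N * (real (m N) * \<mu>\<^sup>2)) * (1 / sqrt (\<gamma> N)) \<le>
        exp (\<mu>\<^sup>2 * real N powr (\<zeta> - \<delta>)) * exp (- (real N powr \<zeta>) / 4)"
      using sg g by (intro mult_mono) auto
    then have 2: "exp (K N * (real (m N) * \<mu>\<^sup>2)) / sqrt (\<gamma> N) \<le>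
        exp (\<mu>\<^sup>2 * real N powr (\<zeta> - \<delta>) - 1 / 4 * (real N powr \<zeta>))"
      by (simp add: exp_add[symmetric])
    have "real N * p N / K N \<le> real N powr 1 * (2 * real N powr (- \<beta>)) / real N powr (1 - \<beta> + \<delta>)"
      unfolding K_def using elim(2) N by (intro divide_right_mono mult_mono) (use p01[OF elim(3)] in auto)
    also have "\<dots> = 2 * (real N powr (1 + (- \<beta>)) / real N powr (1 - \<beta> + \<delta>))"
      by (simp only: powr_add) simp
    also have "\<dots> = 2 * real N powr (- \<delta>)"
      by (simp add: powr_diff[symmetric])
    finally show ?case using 1 2 by (simp add: R_def R'_def)
  qed
  have "(\<lambda>N. 2 * real N powr \<kappa> * exp (- (real N powr \<zeta>) / 4)) \<longlonglongrightarrow> 0"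
    using \<zeta> \<kappa> by real_asymp
  moreover have "(\<lambda>N. exp (\<mu>\<^sup>2 * real N powr (\<zeta> - \<delta>) - 1 / 4 * (real N powr \<zeta>))) \<longlonglongrightarrow> 0"
    using \<zeta> \<delta> by real_asymp
  moreover have "(\<lambda>N. 2 * real N powr (- \<delta>)) \<longlonglongrightarrow> 0"
    using \<delta> by real_asymp
  ultimately have "R' \<longlonglongrightarrow> 0"
    unfolding R'_def by (intro tendsto_add_zero)
  then have "eventually (\<lambda>N. R' N < 1 / 2) sequentially" by (rule order_tendstoD) simp
  moreover have "eventually (\<lambda>N. real N powr \<kappa> / 2 \<le> real (m N)) sequentially"
    unfolding m_def using \<kappa> by real_asymp
  moreover have "eventually (\<lambda>N. 1 \<le> real (m N)) sequentially"
    unfolding m_def using \<kappa> by real_asymp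
  \<comment> \<open>One factor 1/2 pays for rounding \<open>m\<close>, the other for
    \<open>1 - R \<ge> 1/2\<close>; the logarithm absorbs both.\<close>
  ultimately have "eventually (\<lambda>N. 0 < real N powr \<kappa> / 4 \<and>
      ennreal (real N powr \<kappa> / 4) \<le> detection_delay N (p N) \<mu> (T N)) sequentially"
    using R_le eventually_ge_at_top[of 1]
  proof eventually_elim
    case (elim N)
    have g: "0 < \<gamma> N" using \<gamma>1[OF elim(5)] by simp
    have K: "0 < K N" using elim(5) by (simp add: K_def)
    have "real N powr \<kappa> / 4 = (real N powr \<kappa> / 2) * (1 / 2)" by simp
    also have "\<dots> \<le> real (m N) * (1 - R N)"
      using elim(1,2,4) by (intro mult_mono) auto
    finally have "ennreal (real N powr \<kappa> / 4) \<le> ennreal (real (m N) * (1 - R N))"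
      by (rule ennreal_leI)
    also have "\<dots> \<le> detection_delay N (p N) \<mu> (T N)"
      unfolding R_def using p01[OF elim(5)] elim(3) g K
      by (intro detection_delay_ge_truncated T ARL elim(5)) auto
    finally show ?case using elim(5) by simp
  qed
  moreover have "(\<lambda>N. ln (real N powr \<kappa> / 4) / ln (real N)) \<longlonglongrightarrow> \<kappa>"
    using \<kappa> by real_asymp
  ultimately show ?thesis unfolding \<kappa>_def by (rule le_liminf_ln_delay_div_ln)
qed

theorem theorem1:
  fixes \<mu> \<zeta> \<beta> :: real
    and \<gamma> p :: "nat \<Rightarrow> real"
    and T :: "nat \<Rightarrow> path \<Rightarrow> enat"
  assumes "0 < \<mu>" and "0 < \<zeta>" and "\<zeta> < 1"
    and "\<And>N. 1 \<le> N \<Longrightarrow> 1 \<le> \<gamma> N"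
    and "(\<lambda>N. ln (\<gamma> N)) \<sim>[sequentially] (\<lambda>N. real N powr \<zeta>)"
    and "\<And>N. 1 \<le> N \<Longrightarrow> stopping_rule N (T N)"
    and "\<And>N. 1 \<le> N \<Longrightarrow> ennreal (\<gamma> N) \<le> ARL N (T N)"
    and "\<And>N. 1 \<le> N \<Longrightarrow> 0 < p N \<and> p N < 1"
    and "0 < \<beta>" and "\<beta> < 1"
    and "p \<sim>[sequentially] (\<lambda>N. real N powr (- \<beta>))"
  shows "((1 - \<zeta>) / 2 < \<beta> \<and> \<beta> < 1 - \<zeta> \<longrightarrow>
           ereal (2 / \<mu>\<^sup>2 * rho \<beta> \<zeta>)
             \<le> liminf (\<lambda>N. enn2ereal (detection_delay N (p N) \<mu> (T N)) / ereal (ln (real N)))) \<and>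
         (1 - \<zeta> < \<beta> \<longrightarrow>
           ereal (\<beta> + \<zeta> - 1)
             \<le> liminf (\<lambda>N. ext_ln (detection_delay N (p N) \<mu> (T N)) / ereal (ln (real N))))"
    (is "(_ \<longrightarrow> _ \<le> ?A) \<and> (_ \<longrightarrow> _ \<le> ?B)")
proof (intro conjI impI)
  assume \<beta>: "(1 - \<zeta>) / 2 < \<beta> \<and> \<beta> < 1 - \<zeta>"
  have rho: "0 < rho \<beta> \<zeta>" using \<beta> assms by (intro rho_pos) auto
  show "ereal (2 / \<mu>\<^sup>2 * rho \<beta> \<zeta>) \<le> ?A"
  \<comment> \<open>It suffices to reach every positive value below the bound, which leaves the
    strict gap \<open>r < rho \<beta> \<zeta>\<close> that produces the margin in the
    exponent.\<close>
  proof (rule dense_le_bounded[of 0])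
    show "0 < ereal (2 / \<mu>\<^sup>2 * rho \<beta> \<zeta>)" using rho assms(1) by simp
    fix y assume y: "0 < y" "y < ereal (2 / \<mu>\<^sup>2 * rho \<beta> \<zeta>)"
    then obtain x where x: "y = ereal x" by (cases y) auto
    define r where "r = \<mu>\<^sup>2 / 2 * x"
    have xr: "x = 2 / \<mu>\<^sup>2 * r" using assms(1) by (simp add: r_def)
    have r: "0 < r" "r < rho \<beta> \<zeta>" using y assms(1) by (auto simp: x r_def field_simps)
    obtain s where "0 < s" "s \<le> 1" "1 - \<zeta> < (1 + s) * (\<beta> - s * r)"
      using exists_moment_exponent[OF assms(3) _ _ r(2)] \<beta> by auto
    then show "y \<le> ?A"
      unfolding x xr using assms r(1) by (intro detection_delay_dense) auto
  qed
next
  assume \<beta>: "1 - \<zeta> < \<beta>"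
  show "ereal (\<beta> + \<zeta> - 1) \<le> ?B"
  proof (rule dense_le_bounded[of 0])
    show "0 < ereal (\<beta> + \<zeta> - 1)" using \<beta> by simp
    fix y assume y: "0 < y" "y < ereal (\<beta> + \<zeta> - 1)"
    then obtain x where x: "y = ereal x" by (cases y) auto
    \<comment> \<open>Half of the gap to the bound, since the sparse regime loses
      \<open>2 * \<delta>\<close>.\<close>
    define \<delta> where "\<delta> = (\<beta> + \<zeta> - 1 - x) / 2"
    have xd: "x = \<beta> + \<zeta> - 1 - 2 * \<delta>" by (simp add: \<delta>_def field_simps)
    have "0 < \<delta>" "0 < \<beta> + \<zeta> - 1 - 2 * \<delta>" using y unfolding x by (auto simp: \<delta>_def)
    then show "y \<le> ?B"
      unfolding x xd using assms by (intro detection_delay_sparse) auto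
  qed
qed

end
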